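(* Let $K$ be a field, let $n\ge 3$, let $\mathcal{A}=K[x_0,x_1,\ldots,x_{2n}]$, and let $I(H_{0,2n})\subseteq\mathcal{A}$ be the edge ideal of the Helm graph $H_{0,2n}$. Then $$\operatorname{depth}(\mathcal{A}/I(H_{0,2n}))=n.$$
   Context: For $n\ge 3$, the Helm graph $H_{0,2n}$ is the simple graph with vertex set $\{x_0,x_1,\ldots,x_n,x_{n+1},\ldots,x_{2n}\}$ and edge set $$E(C_n)\cup\{\{x_0,x_i\}:1\le i\le n\}\cup\{\{x_i,x_{n+i}\}:1\le i\le n\},$$ where $E(C_n)=\{\{x_i,x_{i+1}\}:1\le i\le n-1\}\cup\{\{x_n,x_1\}\}$ is the edge set of the cycle on $x_1,\dots,x_n$. The edge ideal of a graph $G$ on the variables is the monomial ideal $I(G)=(x_ix_j:\{x_i,x_j\}\in E(G))$. Thus $$I(H_{0,2n})=\left(x_ix_{i+1}\,(1\le i\le n-1),\; x_nx_1,\; x_0x_i\,(1\le i\le n),\; x_ix_{n+i}\,(1\le i\le n)\right).$$ The depth of a finitely generated $\mathcal{A}$-module $M$ is the length of a maximal $M$-regular sequence in the graded maximal ideal $(x_0,\dots,x_{2n})$. *)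

theory Defs
  imports
    "HOL-Algebra.Module"
    "HOL-Algebra.QuotRing"
    "HOL-Library.Poly_Mapping"
begin

section \<open>Regular sequences and depth\<close>

text \<open>The submodule \<open>J M\<close> of \<open>M\<close>, generated by the products \<open>a x\<close> with \<open>a \<in> J\<close>, \<open>x \<in> M\<close>.\<close>

definition ideal_smult :: "('a, 'c) ring_scheme \<Rightarrow> ('a, 'b, 'd) module_scheme \<Rightarrow> 'a set \<Rightarrow> 'b set" where
  "ideal_smult R M J =
     \<Inter>{N. submodule N R M \<and> (\<forall>a\<in>J. \<forall>x\<in>carrier M. a \<odot>\<^bsub>M\<^esub> x \<in> N)}"

text \<open>The condition on \<open>fs ! i\<close> says that it is not a zero divisor on the quotient
  \<open>M / (f\<^sub>0, \<dots>, f\<^sub>i\<^sub>-\<^sub>1) M\<close>, written out on representatives; the last condition is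
  \<open>M \<noteq> (f\<^sub>0, \<dots>, f\<^sub>r\<^sub>-\<^sub>1) M\<close>.\<close>

definition regular_seq :: "('a, 'c) ring_scheme \<Rightarrow> ('a, 'b, 'd) module_scheme \<Rightarrow> 'a list \<Rightarrow> bool" where
  "regular_seq R M fs \<longleftrightarrow>
     set fs \<subseteq> carrier R \<and>
     (\<forall>i<length fs. \<forall>x\<in>carrier M.
        fs ! i \<odot>\<^bsub>M\<^esub> x \<in> ideal_smult R M (Idl\<^bsub>R\<^esub> (set (take i fs))) \<longrightarrow>
        x \<in> ideal_smult R M (Idl\<^bsub>R\<^esub> (set (take i fs)))) \<and>
     ideal_smult R M (Idl\<^bsub>R\<^esub> (set fs)) \<noteq> carrier M"

definition maximal_regular_seq ::
    "('a, 'c) ring_scheme \<Rightarrow> 'a set \<Rightarrow> ('a, 'b, 'd) module_scheme \<Rightarrow> 'a list \<Rightarrow> bool" where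
  "maximal_regular_seq R \<mm> M fs \<longleftrightarrow>
     set fs \<subseteq> \<mm> \<and> regular_seq R M fs \<and> (\<forall>g\<in>\<mm>. \<not> regular_seq R M (fs @ [g]))"

text \<open>The common length of the maximal \<open>M\<close>-regular sequences in \<open>\<mm>\<close>. It is determined only
  when such sequences exist and all have the same length, as they do for a finitely generated
  module \<open>M \<noteq> \<mm> M\<close> over a Noetherian ring.\<close>

definition depth :: "('a, 'c) ring_scheme \<Rightarrow> 'a set \<Rightarrow> ('a, 'b, 'd) module_scheme \<Rightarrow> nat" where
  "depth R \<mm> M = (THE d. \<exists>fs. maximal_regular_seq R \<mm> M fs \<and> length fs = d)"

text \<open>\<open>R / I\<close> as an \<open>R\<close>-module: \<open>a\<close> acts as multiplication by the coset \<open>I + a\<close>.\<close>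

definition quot_module :: "('a, 'c) ring_scheme \<Rightarrow> 'a set \<Rightarrow> ('a, 'a set) module" where
  "quot_module R I =
     ring.extend (R Quot I)
       \<lparr>smult = (\<lambda>a X. (I +>\<^bsub>R\<^esub> a) \<otimes>\<^bsub>R Quot I\<^esub> X)\<rparr>"

section \<open>Polynomial rings and edge ideals\<close>

text \<open>Polynomials with coefficients in \<open>'k\<close> and variables \<open>x\<^sub>v\<close>, \<open>v :: 'v\<close>, are finitely supported
  maps from exponent vectors to coefficients, with the convolution product of
  \<^theory>\<open>HOL-Library.Poly_Mapping\<close>.\<close>

type_synonym ('v, 'k) mpoly = "('v \<Rightarrow>\<^sub>0 nat) \<Rightarrow>\<^sub>0 'k"

definition var :: "'v \<Rightarrow> ('v, 'k::comm_ring_1) mpoly" where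
  "var v = Poly_Mapping.single (Poly_Mapping.single v 1) 1"

text \<open>The ring \<open>K[x\<^sub>v : v \<in> V]\<close> of polynomials in which only variables indexed by \<open>V\<close> occur.\<close>

definition poly_ring :: "'v set \<Rightarrow> ('v, 'k::comm_ring_1) mpoly ring" where
  "poly_ring V =
     \<lparr>carrier = {p. \<forall>m\<in>Poly_Mapping.keys p. Poly_Mapping.keys m \<subseteq> V},
      mult = (*), one = 1, zero = 0, add = (+)\<rparr>"

definition graded_max_ideal :: "'v set \<Rightarrow> ('v, 'k::comm_ring_1) mpoly set" where
  "graded_max_ideal V = Idl\<^bsub>poly_ring V\<^esub> (var ` V)"

text \<open>\<open>V\<close> is the vertex set and \<open>E\<close> the set of edges \<open>{i, j}\<close> of a simple graph.\<close>

definition edge_ideal :: "'v set \<Rightarrow> 'v set set \<Rightarrow> ('v, 'k::comm_ring_1) mpoly set" where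
  "edge_ideal V E = Idl\<^bsub>poly_ring V\<^esub> {var i * var j | i j. {i, j} \<in> E}"

section \<open>The Helm graph\<close>

text \<open>The vertex \<open>x\<^sub>i\<close> is represented by its index \<open>i\<close>.\<close>

definition helm_verts :: "nat \<Rightarrow> nat set" where
  "helm_verts n = {0..2 * n}"

definition cycle_edges :: "nat \<Rightarrow> nat set set" where
  "cycle_edges n = {{i, i + 1} | i. 1 \<le> i \<and> i \<le> n - 1} \<union> {{n, 1}}"

definition helm_edges :: "nat \<Rightarrow> nat set set" where
  "helm_edges n =
     cycle_edges n \<union> {{0, i} | i. 1 \<le> i \<and> i \<le> n} \<union> {{i, n + i} | i. 1 \<le> i \<and> i \<le> n}"

section \<open>Basic facts\<close>

lemma helm_simple_graph:
  assumes "n \<ge> 3" "e \<in> helm_edges n"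
  shows "e \<subseteq> helm_verts n \<and> card e = 2"
  using assms by (auto simp: helm_edges_def cycle_edges_def helm_verts_def card_insert_if)

lemma edge_ideal_helm:
  "edge_ideal V (helm_edges n) = Idl\<^bsub>poly_ring V\<^esub>
    ({var i * var (i + 1) | i. 1 \<le> i \<and> i \<le> n - 1} \<union> {var n * var 1} \<union>
     {var 0 * var i | i. 1 \<le> i \<and> i \<le> n} \<union> {var i * var (n + i) | i. 1 \<le> i \<and> i \<le> n})"
    (is "_ = genideal _ ?S")
proof -
  have "{var i * var j | i j. {i, j} \<in> helm_edges n} = ?S"
    (is "?L = _")
  proof (intro equalityI subsetI)
    fix p assume "p \<in> ?L"
    then obtain i j where p: "p = var i * var j" and e: "{i, j} \<in> helm_edges n"
      by blast
    from e obtain a b where ab: "{i, j} = {a, b}" "var a * var b \<in> ?S"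
      unfolding helm_edges_def cycle_edges_def by blast
    then have "p = var a * var b"
      by (auto simp: p doubleton_eq_iff mult.commute)
    with ab(2) show "p \<in> ?S" by metis
  next
    fix p assume "p \<in> ?S"
    then show "p \<in> ?L"
      unfolding helm_edges_def cycle_edges_def by blast
  qed
  then show ?thesis
    by (simp add: edge_ideal_def)
qed

lemma var_in_poly_ring: "v \<in> V \<Longrightarrow> var v \<in> carrier (poly_ring V)"
  by (simp add: var_def poly_ring_def)

lemma cring_poly_ring: "cring (poly_ring V :: ('v, 'k::comm_ring_1) mpoly ring)"
proof -
  have add: "p + q \<in> carrier (poly_ring V)"
    if "p \<in> carrier (poly_ring V)" "q \<in> carrier (poly_ring V)" for p q :: "('v, 'k) mpoly"
    using that keys_add[of p q] by (fastforce simp: poly_ring_def)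
  have mult: "p * q \<in> carrier (poly_ring V)"
    if "p \<in> carrier (poly_ring V)" "q \<in> carrier (poly_ring V)" for p q :: "('v, 'k) mpoly"
  proof -
    have "Poly_Mapping.keys m \<subseteq> V" if m: "m \<in> Poly_Mapping.keys (p * q)" for m
    proof -
      obtain a b where ab: "m = a + b" "a \<in> Poly_Mapping.keys p" "b \<in> Poly_Mapping.keys q"
        using subsetD[OF keys_mult m] by blast
      have "Poly_Mapping.keys a \<subseteq> V" "Poly_Mapping.keys b \<subseteq> V"
        using ab \<open>p \<in> _\<close> \<open>q \<in> _\<close> by (auto simp: poly_ring_def)
      then show ?thesis
        using keys_add[of a b] ab(1) by blast
    qed
    then show ?thesis by (simp add: poly_ring_def)
  qed
  have simps: "mult (poly_ring V) = ((*) :: ('v, 'k) mpoly \<Rightarrow> _)" "one (poly_ring V) = (1 :: ('v, 'k) mpoly)"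
    "add (poly_ring V) = ((+) :: ('v, 'k) mpoly \<Rightarrow> _)" "zero (poly_ring V) = (0 :: ('v, 'k) mpoly)"
    by (simp_all add: poly_ring_def)
  have zero: "(0 :: ('v, 'k) mpoly) \<in> carrier (poly_ring V)"
    and one: "(1 :: ('v, 'k) mpoly) \<in> carrier (poly_ring V)"
    by (simp_all add: poly_ring_def)
  have uminus: "- p \<in> carrier (poly_ring V)" if "p \<in> carrier (poly_ring V)" for p :: "('v, 'k) mpoly"
    using that by (simp add: poly_ring_def)
  show ?thesis
  proof (rule cringI)
    show "abelian_group (poly_ring V :: ('v, 'k) mpoly ring)"
    proof (rule abelian_groupI, unfold simps)
      fix x :: "('v, 'k) mpoly" assume "x \<in> carrier (poly_ring V)"
      then show "\<exists>y\<in>carrier (poly_ring V). y + x = 0"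
        by (intro bexI[of _ "- x"] uminus) simp_all
    qed (simp_all add: add zero add_ac)
    show "Group.comm_monoid (poly_ring V :: ('v, 'k) mpoly ring)"
      by (rule comm_monoidI, unfold simps) (simp_all add: mult one mult_ac)
  qed (simp add: simps distrib_right)
qed

lemma graded_max_ideal_ideal: "ideal (graded_max_ideal V) (poly_ring V)"
proof -
  interpret cring "poly_ring V" by (rule cring_poly_ring)
  show ?thesis unfolding graded_max_ideal_def
    by (rule genideal_ideal) (auto intro: var_in_poly_ring)
qed

lemma edge_ideal_ideal:
  assumes "\<And>e. e \<in> E \<Longrightarrow> e \<subseteq> V"
  shows "ideal (edge_ideal V E) (poly_ring V)"
proof -
  interpret cring "poly_ring V" by (rule cring_poly_ring)
  have "var i * var j \<in> carrier (poly_ring V)" if "{i, j} \<in> E" for i j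
    using assms[OF that] m_closed[OF var_in_poly_ring var_in_poly_ring, of i j]
    by (simp add: poly_ring_def)
  then show ?thesis unfolding edge_ideal_def
    by (intro genideal_ideal) auto
qed

lemma module_quot_module:
  assumes "cring R" "ideal I R"
  shows "Module.module R (quot_module R I)"
proof -
  interpret cring R by fact
  interpret I: ideal I R by fact
  interpret Q: cring "R Quot I" by (rule I.quotient_is_cring[OF \<open>cring R\<close>])
  interpret h: ring_hom_ring R "R Quot I" "(+>\<^bsub>R\<^esub>) I" by (rule I.rcos_ring_hom_ring)
  have simps: "carrier (quot_module R I) = carrier (R Quot I)"
    "add (quot_module R I) = add (R Quot I)" "zero (quot_module R I) = zero (R Quot I)"
    "smult (quot_module R I) = (\<lambda>a X. (I +>\<^bsub>R\<^esub> a) \<otimes>\<^bsub>R Quot I\<^esub> X)"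
    by (simp_all add: quot_module_def ring.defs)
  show ?thesis
  proof (rule moduleI)
    show "abelian_group (quot_module R I)"
      by (rule abelian_groupI)
        (auto simp: simps Q.a_ac intro: Q.l_neg bexI[of _ "\<ominus>\<^bsub>R Quot I\<^esub> _"])
  qed (use \<open>cring R\<close> in \<open>auto simp: simps Q.l_distr Q.r_distr Q.m_assoc\<close>)
qed

lemma submodule_ideal_smult:
  assumes "Module.module R M" "J \<subseteq> carrier R"
  shows "submodule (ideal_smult R M J) R M"
proof -
  interpret Module.module R M by fact
  let ?S = "{N. submodule N R M \<and> (\<forall>a\<in>J. \<forall>x\<in>carrier M. a \<odot>\<^bsub>M\<^esub> x \<in> N)}"
  have mem: "carrier M \<in> ?S"
    using assms(2) carrier_is_submodule by auto
  have zero: "\<zero>\<^bsub>M\<^esub> \<in> N" if "submodule N R M" for N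
    using that subgroup.one_closed[of N "add_monoid M"] by (simp add: submodule_def)
  show ?thesis unfolding ideal_smult_def
  proof (rule submoduleI)
    show "\<Inter>?S \<subseteq> carrier M" using mem by blast
    show "\<zero>\<^bsub>M\<^esub> \<in> \<Inter>?S" using zero by blast
    show "\<ominus>\<^bsub>M\<^esub> x \<in> \<Inter>?S" if "x \<in> \<Inter>?S" for x
      using that submoduleE(3) by blast
    show "x \<oplus>\<^bsub>M\<^esub> y \<in> \<Inter>?S" if "x \<in> \<Inter>?S" "y \<in> \<Inter>?S" for x y
      using that submoduleE(5) by blast
    show "a \<odot>\<^bsub>M\<^esub> x \<in> \<Inter>?S" if "a \<in> carrier R" "x \<in> \<Inter>?S" for a x
      using that submoduleE(4) by blast
  qed
qed

end

theory Submission
  imports Defs "HOL-Algebra.Ring_Divisibility"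
begin

text \<open>
  Write \<open>I\<close> for the edge ideal and \<open>\<mm>\<close> for the graded maximal ideal. The whiskers supply a regular
  sequence: \<open>x\<^sub>n\<^sub>+\<^sub>j - x\<^sub>j\<close> for \<open>j = 1, \<dots>, n\<close>. Dividing by the first \<open>i\<close> of these elements identifies
  \<open>x\<^sub>n\<^sub>+\<^sub>j\<close> with \<open>x\<^sub>j\<close> for \<open>j \<le> i\<close>, which turns \<open>I\<close> into another monomial ideal, with \<open>x\<^sub>j\<^sup>2\<close> in place of the
  generator \<open>x\<^sub>jx\<^sub>n\<^sub>+\<^sub>j\<close> (\<open>edge_ideal_mod_folding\<close>). In that ideal \<open>x\<^sub>n\<^sub>+\<^sub>i\<^sub>+\<^sub>1\<close> is still a leaf attached to
  \<open>x\<^sub>i\<^sub>+\<^sub>1\<close>, and comparing coefficients shows that the difference of the two variables is not a zero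
  divisor (\<open>leaf_difference_nonzerodivisor\<close>). After all \<open>n\<close> steps the quotient is
  \<open>K[x\<^sub>0, \<dots>, x\<^sub>n]\<close> modulo \<open>x\<^sub>j\<^sup>2\<close>, \<open>x\<^sub>0x\<^sub>j\<close> for \<open>1 \<le> j \<le> n\<close> and the edges of the cycle. There the product of
  the variables of a maximal independent set of the cycle is nonzero and is killed by every
  variable. So \<open>\<mm>\<close> consists of zero divisors on the quotient and the sequence is maximal.

  The depth is the common length of all maximal regular sequences, so it remains to see that they
  all have the same length. This is the theorem of Rees, proved by exchange: over a Noetherian
  ring, if \<open>\<mm>\<close> consists of zero divisors on \<open>R/J\<close> then it kills a single nonzero element of \<open>R/J\<close>
  (prime avoidance among the finitely many maximal annihilators, \<open>common_nonzerodivisor\<close>); this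
  property is inherited when one element of a regular sequence is exchanged for another
  (\<open>has_socle_swap\<close>), and hence when the whole sequence is exchanged for another one of the same
  length (\<open>has_socle_exchange\<close>). Since the module is cyclic, all of this can be said with ideals
  of \<open>R\<close> (\<open>maximal_regular_seq_quot_module_iff\<close>). That the polynomial ring is Noetherian is
  obtained from Dickson's lemma by reducing leading monomials (\<open>noetherian_poly_ring\<close>).
\<close>

section \<open>Zero divisors modulo an ideal\<close>

context cring
begin

definition nonzerodivisor_mod :: "'a set \<Rightarrow> 'a \<Rightarrow> bool" where
  "nonzerodivisor_mod J a \<longleftrightarrow> a \<in> carrier R \<and> (\<forall>x\<in>carrier R. a \<otimes> x \<in> J \<longrightarrow> x \<in> J)"

text \<open>Some nonzero element of \<open>R/J\<close> is killed by \<open>\<mm>\<close>. For ideals \<open>\<mm>\<close> and \<open>J\<close> of a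
  Noetherian ring this is equivalent to \<open>\<mm>\<close> consisting of zero divisors modulo \<open>J\<close>, but it refers to one
  witness \<open>z\<close>, which can be transported from one quotient to another.\<close>
definition has_socle :: "'a set \<Rightarrow> 'a set \<Rightarrow> bool" where
  "has_socle \<mm> J \<longleftrightarrow> (\<exists>z\<in>carrier R - J. \<forall>a\<in>\<mm>. a \<otimes> z \<in> J)"

text \<open>Weak regularity leaves out the condition that the sequence generates a proper ideal together
  with \<open>J\<close>, which is automatic for sequences in a proper ideal that contains \<open>J\<close>.\<close>
definition weakly_regular :: "'a set \<Rightarrow> 'a list \<Rightarrow> bool" where
  "weakly_regular J fs \<longleftrightarrow>
     (\<forall>i<length fs. nonzerodivisor_mod (Idl (J \<union> set (take i fs))) (fs ! i))"

definition colon :: "'a set \<Rightarrow> 'a \<Rightarrow> 'a set" where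
  "colon J z = {x \<in> carrier R. x \<otimes> z \<in> J}"

lemma ideal_simps:
  assumes "ideal J R"
  shows "\<zero> \<in> J" and "x \<in> J \<Longrightarrow> x \<in> carrier R" and "x \<in> J \<Longrightarrow> y \<in> J \<Longrightarrow> x \<oplus> y \<in> J"
    and "x \<in> J \<Longrightarrow> y \<in> J \<Longrightarrow> x \<ominus> y \<in> J"
    and "x \<in> J \<Longrightarrow> a \<in> carrier R \<Longrightarrow> a \<otimes> x \<in> J"
    and "x \<in> J \<Longrightarrow> a \<in> carrier R \<Longrightarrow> x \<otimes> a \<in> J"
proof -
  interpret ideal J R by fact
  show "\<zero> \<in> J" "x \<in> J \<Longrightarrow> x \<in> carrier R" "x \<in> J \<Longrightarrow> y \<in> J \<Longrightarrow> x \<oplus> y \<in> J"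
    by (auto simp: Icarr)
  show "x \<in> J \<Longrightarrow> y \<in> J \<Longrightarrow> x \<ominus> y \<in> J"
    by (simp add: a_minus_def)
  show "x \<in> J \<Longrightarrow> a \<in> carrier R \<Longrightarrow> a \<otimes> x \<in> J" "x \<in> J \<Longrightarrow> a \<in> carrier R \<Longrightarrow> x \<otimes> a \<in> J"
    by (auto simp: I_l_closed I_r_closed)
qed

lemma idealI_cring:
  assumes "J \<subseteq> carrier R" "\<zero> \<in> J" "\<And>x y. x \<in> J \<Longrightarrow> y \<in> J \<Longrightarrow> x \<oplus> y \<in> J"
    and mult: "\<And>a x. a \<in> carrier R \<Longrightarrow> x \<in> J \<Longrightarrow> a \<otimes> x \<in> J"
  shows "ideal J R"
proof (rule idealI)
  show "subgroup J (add_monoid R)"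
  proof (rule add.subgroupI)
    fix a assume a: "a \<in> J"
    then have "\<ominus> a = (\<ominus> \<one>) \<otimes> a" using assms(1) by (auto simp: l_minus)
    then show "\<ominus> a \<in> J" using mult[of "\<ominus> \<one>" a] a by simp
  qed (use assms in auto)
  show "x \<otimes> a \<in> J" if "a \<in> J" "x \<in> carrier R" for a x using that mult by auto
  show "a \<otimes> x \<in> J" if "a \<in> J" "x \<in> carrier R" for a x
    using that mult[of x a] assms(1) by (auto simp: m_comm)
qed (rule ring_axioms)

lemma colon_ideal:
  assumes "ideal J R" "z \<in> carrier R"
  shows "ideal (colon J z) R"
  unfolding colon_def
  by (rule idealI_cring) (use assms ideal_simps[OF assms(1)] in \<open>auto simp: l_distr m_assoc\<close>)

lemma Idl_Idl_Un:
  assumes "A \<subseteq> carrier R" "B \<subseteq> carrier R"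
  shows "Idl (Idl A \<union> B) = Idl (A \<union> B)"
proof
  have 1: "Idl A \<subseteq> carrier R"
    using genideal_ideal[OF assms(1)] ideal_simps(2) by blast
  show "Idl (Idl A \<union> B) \<subseteq> Idl (A \<union> B)"
  proof (rule genideal_minimal)
    show "ideal (Idl (A \<union> B)) R" by (intro genideal_ideal) (use assms in auto)
    show "Idl A \<union> B \<subseteq> Idl (A \<union> B)"
      using assms genideal_self[of "A \<union> B"] subset_Idl_subset[of "A \<union> B" A] by auto
  qed
  show "Idl (A \<union> B) \<subseteq> Idl (Idl A \<union> B)"
  proof (rule genideal_minimal)
    show "ideal (Idl (Idl A \<union> B)) R" by (intro genideal_ideal) (use assms 1 in auto)
    show "A \<union> B \<subseteq> Idl (Idl A \<union> B)"
      using assms 1 genideal_self[of "Idl A \<union> B"] genideal_self[of A] by auto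
  qed
qed

lemma Idl_insert_mem_iff:
  assumes "ideal J R" "f \<in> carrier R"
  shows "x \<in> Idl (insert f J) \<longleftrightarrow> (\<exists>j\<in>J. \<exists>a\<in>carrier R. x = j \<oplus> f \<otimes> a)"
proof
  note J = ideal_simps[OF assms(1)]
  define S where "S = {x. \<exists>j\<in>J. \<exists>a\<in>carrier R. x = j \<oplus> f \<otimes> a}"
  have sub: "insert f J \<subseteq> carrier R" using J assms by auto
  have "ideal S R"
  proof (rule idealI_cring)
    show "S \<subseteq> carrier R" unfolding S_def using J assms by auto
    have "\<zero> = \<zero> \<oplus> f \<otimes> \<zero>" using assms by simp
    then show "\<zero> \<in> S" unfolding S_def using J(1) by blast
    fix x y assume x: "x \<in> S"
    then obtain j a where x': "j \<in> J" "a \<in> carrier R" "x = j \<oplus> f \<otimes> a" unfolding S_def by blast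
    { assume "y \<in> S"
      then obtain i b where y': "i \<in> J" "b \<in> carrier R" "y = i \<oplus> f \<otimes> b" unfolding S_def by blast
      have "j \<in> carrier R" "i \<in> carrier R" using x' y' J(2) by auto
      then have "x \<oplus> y = (j \<oplus> i) \<oplus> f \<otimes> (a \<oplus> b)"
        using x' y' assms(2) by (simp add: r_distr a_ac)
      then show "x \<oplus> y \<in> S" unfolding S_def using x' y' J(3) by blast }
    { fix c assume c: "c \<in> carrier R"
      have "c \<otimes> x = c \<otimes> j \<oplus> f \<otimes> (c \<otimes> a)"
        using x' c assms(2) J(2) by (simp add: r_distr m_ac)
      then show "c \<otimes> x \<in> S" unfolding S_def using x' c J(5) by blast }
  qed
  moreover have "insert f J \<subseteq> S"
  proof -
    have "f = \<zero> \<oplus> f \<otimes> \<one>" using assms by simp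
    then have "f \<in> S" unfolding S_def using J(1) by blast
    moreover have "j = j \<oplus> f \<otimes> \<zero>" if "j \<in> J" for j using that J(2) assms by simp
    ultimately show ?thesis unfolding S_def by blast
  qed
  ultimately have "Idl (insert f J) \<subseteq> S" by (rule genideal_minimal)
  then show "x \<in> Idl (insert f J) \<Longrightarrow> \<exists>j\<in>J. \<exists>a\<in>carrier R. x = j \<oplus> f \<otimes> a"
    unfolding S_def by blast
  note K = ideal_simps[OF genideal_ideal[OF sub]]
  show "\<exists>j\<in>J. \<exists>a\<in>carrier R. x = j \<oplus> f \<otimes> a \<Longrightarrow> x \<in> Idl (insert f J)"
    using genideal_self[OF sub] K(3,6) by blast
qed

text \<open>If \<open>z\<close> represents a socle element modulo \<open>J + (x)\<close>, then \<open>y z\<close> is \<open>x w\<close> modulo \<open>J\<close>, since \<open>y \<in> \<mm>\<close>.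
  This \<open>w\<close> represents a socle element modulo \<open>J + (y)\<close>: the relation is symmetric in \<open>x, z\<close> and
  \<open>y, w\<close>, so \<open>w \<in> J + (y)\<close> would give \<open>z \<in> J + (x)\<close> after cancelling \<open>x\<close> and \<open>y\<close>, and likewise for the
  products with elements of \<open>\<mm>\<close>.\<close>
lemma has_socle_swap:
  assumes J: "ideal J R" and \<mm>: "\<mm> \<subseteq> carrier R"
    and x: "nonzerodivisor_mod J x" and y: "nonzerodivisor_mod J y" "y \<in> \<mm>"
    and soc: "has_socle \<mm> (Idl (insert x J))"
  shows "has_socle \<mm> (Idl (insert y J))"
proof -
  note Js = ideal_simps[OF J]
  have xc: "x \<in> carrier R" and yc: "y \<in> carrier R"
    using x y by (auto simp: nonzerodivisor_mod_def)
  note memx = Idl_insert_mem_iff[OF J xc] and memy = Idl_insert_mem_iff[OF J yc]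
  obtain z where z: "z \<in> carrier R" "z \<notin> Idl (insert x J)"
    and mz: "\<And>a. a \<in> \<mm> \<Longrightarrow> a \<otimes> z \<in> Idl (insert x J)"
    using soc by (auto simp: has_socle_def)
  obtain j w where j: "j \<in> J" and w: "w \<in> carrier R" and yz: "y \<otimes> z = j \<oplus> x \<otimes> w"
    using mz[OF y(2)] memx by blast
  have jc: "j \<in> carrier R" using j Js(2) by blast
  have "w \<notin> Idl (insert y J)"
  proof
    assume "w \<in> Idl (insert y J)"
    then obtain i u where i: "i \<in> J" and u: "u \<in> carrier R" and w': "w = i \<oplus> y \<otimes> u"
      using memy by blast
    have ic: "i \<in> carrier R" using i Js(2) by blast
    have "y \<otimes> (z \<ominus> x \<otimes> u) = y \<otimes> z \<ominus> x \<otimes> (y \<otimes> u)"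
      using yc z(1) xc u by algebra
    also have "\<dots> = j \<oplus> x \<otimes> i"
      unfolding yz w' using yc xc u ic jc by algebra
    finally have "y \<otimes> (z \<ominus> x \<otimes> u) \<in> J" using Js i j xc by auto
    then have "z \<ominus> x \<otimes> u \<in> J" using y(1) z(1) xc u by (auto simp: nonzerodivisor_mod_def)
    moreover have "z = (z \<ominus> x \<otimes> u) \<oplus> x \<otimes> u" using z(1) xc u by algebra
    ultimately show False using z(2) memx u by blast
  qed
  moreover have "a \<otimes> w \<in> Idl (insert y J)" if a: "a \<in> \<mm>" for a
  proof -
    have ac: "a \<in> carrier R" using a \<mm> by blast
    obtain i b where i: "i \<in> J" and b: "b \<in> carrier R" and az: "a \<otimes> z = i \<oplus> x \<otimes> b"
      using mz[OF a] memx by blast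
    have ic: "i \<in> carrier R" using i Js(2) by blast
    have "x \<otimes> (a \<otimes> w \<ominus> y \<otimes> b) = a \<otimes> (j \<oplus> x \<otimes> w) \<ominus> a \<otimes> j \<ominus> y \<otimes> (x \<otimes> b)"
      using xc yc ac b w jc by algebra
    also have "\<dots> = y \<otimes> (a \<otimes> z) \<ominus> a \<otimes> j \<ominus> y \<otimes> (x \<otimes> b)"
      unfolding yz[symmetric] using xc yc ac b jc z(1) by algebra
    also have "\<dots> = y \<otimes> i \<ominus> a \<otimes> j"
      unfolding az using xc yc ac b jc ic by algebra
    finally have "x \<otimes> (a \<otimes> w \<ominus> y \<otimes> b) \<in> J" using Js i j yc ac by auto
    then have "a \<otimes> w \<ominus> y \<otimes> b \<in> J"
      using x ac w yc b by (auto simp: nonzerodivisor_mod_def)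
    moreover have "a \<otimes> w = (a \<otimes> w \<ominus> y \<otimes> b) \<oplus> y \<otimes> b" using ac w yc b by algebra
    ultimately show ?thesis using memy b by blast
  qed
  ultimately show ?thesis using w by (auto simp: has_socle_def)
qed

text \<open>One half of the fact that regular sequences \<open>x, z\<close> may be permuted when \<open>z\<close> is regular as
  well: a relation \<open>x a = j + z b\<close> puts \<open>b\<close> into \<open>J + (x)\<close>, and then \<open>x\<close> can be cancelled.\<close>
lemma nonzerodivisor_mod_swap:
  assumes J: "ideal J R" and x: "nonzerodivisor_mod J x"
    and z: "nonzerodivisor_mod (Idl (insert x J)) z"
  shows "nonzerodivisor_mod (Idl (insert z J)) x"
proof -
  note Js = ideal_simps[OF J]
  have xc: "x \<in> carrier R" and zc: "z \<in> carrier R" using x z by (auto simp: nonzerodivisor_mod_def)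
  note memx = Idl_insert_mem_iff[OF J xc] and memz = Idl_insert_mem_iff[OF J zc]
  have "a \<in> Idl (insert z J)" if a: "a \<in> carrier R" and xa: "x \<otimes> a \<in> Idl (insert z J)" for a
  proof -
    obtain j b where j: "j \<in> J" and b: "b \<in> carrier R" and e: "x \<otimes> a = j \<oplus> z \<otimes> b"
      using xa memz by blast
    have jc: "j \<in> carrier R" using j Js(2) by blast
    have "z \<otimes> b = (\<ominus> \<one>) \<otimes> j \<oplus> (j \<oplus> z \<otimes> b)" using zc b jc by algebra
    then have "z \<otimes> b = (\<ominus> \<one>) \<otimes> j \<oplus> x \<otimes> a" unfolding e .
    moreover have "(\<ominus> \<one>) \<otimes> j \<in> J" using j by (intro Js(5)) auto
    ultimately have "z \<otimes> b \<in> Idl (insert x J)" using memx a by blast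
    then have "b \<in> Idl (insert x J)" using z b by (auto simp: nonzerodivisor_mod_def)
    then obtain i c where i: "i \<in> J" and c: "c \<in> carrier R" and b': "b = i \<oplus> x \<otimes> c"
      using memx by blast
    have ic: "i \<in> carrier R" using i Js(2) by blast
    have "x \<otimes> (a \<ominus> z \<otimes> c) = x \<otimes> a \<ominus> z \<otimes> (x \<otimes> c)" using xc a zc c by algebra
    also have "\<dots> = j \<oplus> z \<otimes> i" unfolding e b' using xc zc c jc ic by algebra
    finally have "x \<otimes> (a \<ominus> z \<otimes> c) \<in> J" using Js i j zc by auto
    then have "a \<ominus> z \<otimes> c \<in> J" using x a zc c by (auto simp: nonzerodivisor_mod_def)
    moreover have "a = (a \<ominus> z \<otimes> c) \<oplus> z \<otimes> c" using a zc c by algebra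
    ultimately show ?thesis using memz c by blast
  qed
  then show ?thesis using xc by (auto simp: nonzerodivisor_mod_def)
qed

section \<open>Prime avoidance and maximal annihilators\<close>

lemma prime_omits_finite_product:
  assumes P: "primeideal P R" and "finite F"
    and "\<And>Q. Q \<in> F \<Longrightarrow> ideal Q R \<and> \<not> Q \<subseteq> P"
  shows "\<exists>a\<in>carrier R - P. \<forall>Q\<in>F. a \<in> Q"
  using assms(2,3)
proof (induction F rule: finite_induct)
  case empty
  have "P \<noteq> carrier R" "P \<subseteq> carrier R"
    using primeideal.I_notcarr[OF P] ideal_simps(2)[OF primeideal.axioms(1)[OF P]] by auto
  then show ?case by auto
next
  case (insert Q F)
  obtain a where a: "a \<in> carrier R - P" "\<forall>Q\<in>F. a \<in> Q" using insert by auto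
  obtain q where q: "q \<in> Q" "q \<notin> P" "ideal Q R" using insert.prems[of Q] by auto
  have qc: "q \<in> carrier R" using ideal_simps(2)[OF q(3)] q(1) by auto
  have "q \<otimes> a \<notin> P"
    using primeideal.I_prime[OF P, of q a] a q qc by blast
  moreover have "q \<otimes> a \<in> Q'" if "Q' \<in> insert Q F" for Q'
    using that a q qc insert.prems[OF that] ideal_simps(5,6) by auto
  ultimately show ?case using a qc by (intro bexI[of _ "q \<otimes> a"]) auto
qed

text \<open>Induction on the number of primes. Removing an inclusion-minimal prime \<open>P\<close>, one has \<open>g \<in> \<mm>\<close> outside
  the other primes. If \<open>g \<in> P\<close>, it is corrected by an element of \<open>\<mm>\<close> that lies in all the others
  but not in \<open>P\<close>; minimality of \<open>P\<close> makes such an element available.\<close>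
lemma prime_avoidance:
  assumes \<mm>: "ideal \<mm> R" and "finite F"
    and "\<And>P. P \<in> F \<Longrightarrow> primeideal P R \<and> \<not> \<mm> \<subseteq> P"
  shows "\<exists>g\<in>\<mm>. \<forall>P\<in>F. g \<notin> P"
  using assms(2,3)
proof (induction F rule: finite_psubset_induct)
  case (psubset F)
  show ?case
  proof (cases "F = {}")
    case True then show ?thesis using ideal_simps(1)[OF \<mm>] by auto
  next
    case False
    then obtain P where P: "P \<in> F" and min: "\<And>Q. Q \<in> F \<Longrightarrow> Q \<subseteq> P \<Longrightarrow> Q = P"
      using finite_has_minimal[OF psubset.hyps] by metis
    have "\<exists>g\<in>\<mm>. \<forall>Q\<in>F - {P}. g \<notin> Q"
      by (rule psubset.IH) (use P psubset.prems in auto)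
    then obtain g where g: "g \<in> \<mm>" "\<And>Q. Q \<in> F \<Longrightarrow> Q \<noteq> P \<Longrightarrow> g \<notin> Q" by auto
    show ?thesis
    proof (cases "g \<in> P")
      case False then show ?thesis using g by metis
    next
      case True
      have id: "ideal Q R" if "Q \<in> F" for Q
        using psubset.prems[OF that] primeideal.axioms(1) by blast
      have "\<exists>h\<in>carrier R - P. \<forall>Q\<in>insert \<mm> (F - {P}). h \<in> Q"
        by (rule prime_omits_finite_product)
          (use psubset.hyps psubset.prems P \<mm> min id in auto)
      then obtain h where h: "h \<in> carrier R" "h \<notin> P" "h \<in> \<mm>"
        "\<And>Q. Q \<in> F \<Longrightarrow> Q \<noteq> P \<Longrightarrow> h \<in> Q" by auto
      have gc: "g \<in> carrier R" using g ideal_simps(2)[OF \<mm>] by auto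
      have e1: "h = (g \<oplus> h) \<ominus> g" and e2: "g = (g \<oplus> h) \<ominus> h" using gc h(1) by algebra+
      have "g \<oplus> h \<notin> P" using e1 True h(2) ideal_simps(4)[OF id[OF P]] by metis
      moreover have "g \<oplus> h \<notin> Q" if "Q \<in> F" "Q \<noteq> P" for Q
        using e2 g(2)[OF that] h(4)[OF that] ideal_simps(4)[OF id[OF that(1)]] by metis
      ultimately show ?thesis using ideal_simps(3)[OF \<mm> g(1) h(3)] by metis
    qed
  qed
qed

end

lemma (in noetherian_ring) exists_maximal_ideal_above:
  assumes "\<And>J. J \<in> C \<Longrightarrow> ideal J R" and "J \<in> C"
  shows "\<exists>M\<in>C. J \<subseteq> M \<and> (\<forall>K\<in>C. M \<subseteq> K \<longrightarrow> K = M)"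
proof -
  let ?C = "{K \<in> C. J \<subseteq> K}"
  have "\<exists>M\<in>?C. \<forall>X\<in>?C. M \<subseteq> X \<longrightarrow> X = M"
  proof (rule subset_Zorn)
    fix D assume D: "subset.chain ?C D"
    show "\<exists>U\<in>?C. \<forall>X\<in>D. X \<subseteq> U"
    proof (cases "D = {}")
      case True then show ?thesis using assms(2) by auto
    next
      case False
      have "subset.chain {I. ideal I R} D"
        using D assms(1) by (auto simp: subset.chain_def)
      then have "\<Union>D \<in> D" using ideal_chain_is_trivial False by blast
      then show ?thesis using D by (auto simp: subset.chain_def)
    qed
  qed
  then show ?thesis by (metis (mono_tags, lifting) mem_Collect_eq order_trans)
qed

locale noetherian_cring = noetherian_ring + cring
begin

text \<open>The ideals \<open>J : z\<close> with \<open>z \<notin> J\<close> are the annihilators of the nonzero elements of \<open>R/J\<close>. The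
  maximal ones are the maximal associated primes of \<open>R/J\<close>; their union is the set of zero divisors.\<close>
definition maximal_colons :: "'a set \<Rightarrow> 'a set set" where
  "maximal_colons J =
     {P \<in> colon J ` (carrier R - J). \<forall>Q\<in>colon J ` (carrier R - J). P \<subseteq> Q \<longrightarrow> Q = P}"

lemma zero_divisor_in_maximal_colon:
  assumes J: "ideal J R" and a: "a \<in> carrier R" "\<not> nonzerodivisor_mod J a"
  shows "\<exists>P\<in>maximal_colons J. a \<in> P"
proof -
  obtain z where z: "z \<in> carrier R - J" "a \<otimes> z \<in> J"
    using a by (auto simp: nonzerodivisor_mod_def)
  have "\<exists>M\<in>colon J ` (carrier R - J). colon J z \<subseteq> M \<and>
      (\<forall>K\<in>colon J ` (carrier R - J). M \<subseteq> K \<longrightarrow> K = M)"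
    by (rule exists_maximal_ideal_above) (use z colon_ideal[OF J] in auto)
  moreover have "a \<in> colon J z" using z a by (simp add: colon_def)
  ultimately show ?thesis unfolding maximal_colons_def by blast
qed

text \<open>If \<open>a z \<notin> J\<close>, then \<open>J : a z\<close> contains \<open>J : z\<close>, so maximality makes them equal; any \<open>b\<close> with
  \<open>a b z \<in> J\<close> therefore lies in \<open>J : z\<close>.\<close>
lemma maximal_colon_prime:
  assumes J: "ideal J R" and P: "P \<in> maximal_colons J"
  shows "primeideal P R"
proof -
  obtain z where z: "z \<in> carrier R" "z \<notin> J" and Pz: "P = colon J z"
    and max: "\<And>w. w \<in> carrier R - J \<Longrightarrow> P \<subseteq> colon J w \<Longrightarrow> colon J w = P"
    using P unfolding maximal_colons_def by auto
  note Js = ideal_simps[OF J]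
  show ?thesis
  proof (rule primeidealI)
    show "ideal P R" unfolding Pz by (rule colon_ideal[OF J z(1)])
    show "cring R" by (rule cring_axioms)
    have "\<one> \<notin> P" using z by (simp add: Pz colon_def)
    then show "carrier R \<noteq> P" by auto
    fix a b assume ab: "a \<in> carrier R" "b \<in> carrier R" "a \<otimes> b \<in> P"
    show "a \<in> P \<or> b \<in> P"
    proof (cases "a \<in> P")
      case False
      then have 1: "a \<otimes> z \<in> carrier R - J" using ab z by (simp add: Pz colon_def)
      have "P \<subseteq> colon J (a \<otimes> z)"
      proof
        fix p assume "p \<in> P"
        then have p: "p \<in> carrier R" "p \<otimes> z \<in> J" by (auto simp: Pz colon_def)
        have "p \<otimes> (a \<otimes> z) = a \<otimes> (p \<otimes> z)" using p ab z by (simp add: m_ac)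
        then show "p \<in> colon J (a \<otimes> z)" using p ab Js(5) by (simp add: colon_def)
      qed
      then have "colon J (a \<otimes> z) = P" using max[OF 1] by blast
      moreover have "b \<in> colon J (a \<otimes> z)"
        using ab z by (auto simp: Pz colon_def m_ac)
      ultimately show ?thesis by simp
    qed simp
  qed
qed

text \<open>Write the maximal annihilators as \<open>P = J : w\<^sub>P\<close>. By the Noetherian property finitely many \<open>w\<^sub>Q\<close>
  generate the ideal of all \<open>w\<^sub>P\<close>. An element in all the corresponding \<open>Q\<close> kills every generator
  modulo \<open>J\<close>, hence every \<open>w\<^sub>P\<close>; so the prime \<open>P\<close> contains the intersection of those \<open>Q\<close>, hence one of
  them, and equals it by maximality.\<close>
lemma finite_maximal_colons:
  assumes J: "ideal J R"
  shows "finite (maximal_colons J)"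
proof -
  note Js = ideal_simps[OF J]
  have "\<forall>P\<in>maximal_colons J. \<exists>z. z \<in> carrier R - J \<and> P = colon J z"
    unfolding maximal_colons_def by auto
  then obtain w where w: "\<And>P. P \<in> maximal_colons J \<Longrightarrow> w P \<in> carrier R - J \<and> P = colon J (w P)"
    by metis
  define C where "C = {Idl (w ` F) | F. finite F \<and> F \<subseteq> maximal_colons J}"
  have C: "K \<in> C \<longleftrightarrow> (\<exists>F. K = Idl (w ` F) \<and> finite F \<and> F \<subseteq> maximal_colons J)" for K
    by (simp add: C_def)
  have sub: "w ` F \<subseteq> carrier R" if "F \<subseteq> maximal_colons J" for F using w that by auto
  \<comment> \<open>A maximal member of \<open>C\<close> already contains all the elements \<open>w P\<close>.\<close>
  have "\<exists>M\<in>C. Idl (w ` {}) \<subseteq> M \<and> (\<forall>K\<in>C. M \<subseteq> K \<longrightarrow> K = M)"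
  proof (rule exists_maximal_ideal_above)
    show "Idl (w ` {}) \<in> C" unfolding C by (intro exI[of _ "{}"]) simp
    show "ideal K R" if "K \<in> C" for K
      using that genideal_ideal[OF sub] unfolding C by auto
  qed
  then obtain M where M: "M \<in> C" "\<And>K. K \<in> C \<Longrightarrow> M \<subseteq> K \<Longrightarrow> K = M" by auto
  from M(1) obtain F where F: "M = Idl (w ` F)" "finite F" "F \<subseteq> maximal_colons J"
    unfolding C by auto
  have max: "Idl (w ` G) = Idl (w ` F)"
    if "finite G" "G \<subseteq> maximal_colons J" "Idl (w ` F) \<subseteq> Idl (w ` G)" for G
  proof -
    have "Idl (w ` G) \<in> C" unfolding C using that by auto
    then show ?thesis using M(2) that(3) F(1) by simp
  qed
  have "maximal_colons J \<subseteq> F"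
  proof
    fix P assume P: "P \<in> maximal_colons J"
    have "Idl (w ` insert P F) = Idl (w ` F)"
    proof (rule max)
      show "Idl (w ` F) \<subseteq> Idl (w ` insert P F)"
        using P F by (intro subset_Idl_subset sub) auto
    qed (use F P in auto)
    then have wP: "w P \<in> Idl (w ` F)"
      using genideal_self[OF sub[of "insert P F"]] F P by auto
    have "\<exists>Q\<in>F. Q \<subseteq> P"
    proof (rule ccontr)
      assume "\<not> (\<exists>Q\<in>F. Q \<subseteq> P)"
      then have "\<exists>a\<in>carrier R - P. \<forall>Q\<in>F. a \<in> Q"
        using F w colon_ideal[OF J]
        by (intro prime_omits_finite_product maximal_colon_prime[OF J P]) (metis DiffD1 subsetD)+
      then obtain a where a: "a \<in> carrier R" "a \<notin> P" "\<And>Q. Q \<in> F \<Longrightarrow> a \<in> Q" by auto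
      have "Idl (w ` F) \<subseteq> colon J a"
      proof (rule genideal_minimal[OF colon_ideal[OF J a(1)]])
        show "w ` F \<subseteq> colon J a"
        proof
          fix y assume "y \<in> w ` F"
          then obtain Q where Q: "Q \<in> F" "y = w Q" by auto
          then have "a \<in> colon J (w Q)" using a(3) w F by blast
          then show "y \<in> colon J a" using w[of Q] Q F a(1) by (auto simp: colon_def m_comm)
        qed
      qed
      then have "a \<in> colon J (w P)" using wP a(1) by (auto simp: colon_def m_comm)
      then show False using a(2) w[OF P] by simp
    qed
    then obtain Q where Q: "Q \<in> F" "Q \<subseteq> P" by auto
    then have "P = Q" using P F unfolding maximal_colons_def by auto
    then show "P \<in> F" using Q by simp
  qed
  then show ?thesis using F finite_subset by blast
qed

text \<open>An annihilator \<open>J : z\<close> that contains \<open>\<mm>\<close> would exhibit \<open>z\<close> as a socle element, so prime avoidance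
  applies to the maximal annihilators of all the given ideals at once.\<close>
lemma common_nonzerodivisor:
  assumes \<mm>: "ideal \<mm> R" and "finite \<J>"
    and \<J>: "\<And>J. J \<in> \<J> \<Longrightarrow> ideal J R \<and> \<not> has_socle \<mm> J"
  shows "\<exists>g\<in>\<mm>. \<forall>J\<in>\<J>. nonzerodivisor_mod J g"
proof -
  have "\<exists>g\<in>\<mm>. \<forall>P\<in>(\<Union>J\<in>\<J>. maximal_colons J). g \<notin> P"
  proof (rule prime_avoidance[OF \<mm>])
    show "finite (\<Union>J\<in>\<J>. maximal_colons J)"
      using assms finite_maximal_colons by auto
    fix P assume "P \<in> (\<Union>J\<in>\<J>. maximal_colons J)"
    then obtain J where J: "J \<in> \<J>" "P \<in> maximal_colons J" by auto
    obtain z where z: "z \<in> carrier R - J" "P = colon J z"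
      using J unfolding maximal_colons_def by auto
    have "\<not> \<mm> \<subseteq> P"
    proof
      assume "\<mm> \<subseteq> P"
      then have "has_socle \<mm> J" unfolding has_socle_def using z by (auto simp: colon_def)
      then show False using \<J>[OF J(1)] by simp
    qed
    then show "primeideal P R \<and> \<not> \<mm> \<subseteq> P" using maximal_colon_prime J \<J> by blast
  qed
  then obtain g where g: "g \<in> \<mm>" "\<And>J P. J \<in> \<J> \<Longrightarrow> P \<in> maximal_colons J \<Longrightarrow> g \<notin> P" by auto
  have "nonzerodivisor_mod J g" if "J \<in> \<J>" for J
    using zero_divisor_in_maximal_colon[of J g] g that \<J> ideal_simps(2)[OF \<mm>] by metis
  then show ?thesis using g by auto
qed

end

section \<open>Exchange of regular sequences\<close>

context cring
begin

lemma not_has_socle_if_nonzerodivisor: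
  assumes "nonzerodivisor_mod J g" "g \<in> \<mm>"
  shows "\<not> has_socle \<mm> J"
  using assms by (auto simp: nonzerodivisor_mod_def has_socle_def)

lemma weakly_regular_append1:
  "weakly_regular J (fs @ [f]) \<longleftrightarrow>
     weakly_regular J fs \<and> nonzerodivisor_mod (Idl (J \<union> set fs)) f"
  by (auto simp: weakly_regular_def nth_append less_Suc_eq)

lemma weakly_regular_take:
  "weakly_regular J fs \<Longrightarrow> weakly_regular J (take k fs)"
  by (auto simp: weakly_regular_def min_def)

text \<open>An element that is regular modulo every initial part of a regular sequence can be moved from
  the end of the sequence to its beginning.\<close>
lemma weakly_regular_mod_first:
  assumes J: "ideal J R" and z: "z \<in> carrier R" and fs: "set fs \<subseteq> carrier R"
    and reg: "weakly_regular J fs"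
    and nzd: "\<And>i. i \<le> length fs \<Longrightarrow> nonzerodivisor_mod (Idl (J \<union> set (take i fs))) z"
  shows "weakly_regular (Idl (insert z J)) fs"
  unfolding weakly_regular_def
proof (intro allI impI)
  fix i assume i: "i < length fs"
  let ?T = "set (take i fs)"
  have J': "J \<subseteq> carrier R" using ideal_simps(2)[OF J] by auto
  have T: "?T \<subseteq> carrier R" using fs set_take_subset by fastforce
  have fi: "fs ! i \<in> carrier R" using fs i by auto
  have "nonzerodivisor_mod (Idl (insert z (Idl (J \<union> ?T)))) (fs ! i)"
  proof (rule nonzerodivisor_mod_swap)
    show "ideal (Idl (J \<union> ?T)) R" using J' T by (intro genideal_ideal) auto
    show "nonzerodivisor_mod (Idl (J \<union> ?T)) (fs ! i)"
      using reg i by (auto simp: weakly_regular_def)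
    have "Idl (insert (fs ! i) (Idl (J \<union> ?T))) = Idl (J \<union> set (take (Suc i) fs))"
      using Idl_Idl_Un[of "J \<union> ?T" "{fs ! i}"] J' T fi i
      by (simp add: take_Suc_conv_app_nth Un_assoc)
    then show "nonzerodivisor_mod (Idl (insert (fs ! i) (Idl (J \<union> ?T)))) z"
      using nzd[of "Suc i"] i by simp
  qed
  moreover have "Idl (insert z (Idl (J \<union> ?T))) = Idl (Idl (insert z J) \<union> ?T)"
    using Idl_Idl_Un[of "J \<union> ?T" "{z}"] Idl_Idl_Un[of "insert z J" ?T] J' T z by simp
  ultimately show "nonzerodivisor_mod (Idl (Idl (insert z J) \<union> ?T)) (fs ! i)" by simp
qed

end

context noetherian_cring
begin

text \<open>Choose \<open>z \<in> \<mm>\<close> regular modulo all the proper initial parts of both sequences. The last elements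
  may be replaced by \<open>z\<close> by \<open>has_socle_swap\<close>, and \<open>z\<close> may be moved to the front. Then both sequences
  start with \<open>z\<close>, and the shorter remainders are compared modulo \<open>J + (z)\<close>.\<close>
lemma has_socle_exchange:
  assumes \<mm>: "ideal \<mm> R"
  shows "\<lbrakk>ideal J R; set fs \<subseteq> \<mm>; set gs \<subseteq> \<mm>; length fs = k; length gs = k;
    weakly_regular J fs; weakly_regular J gs; has_socle \<mm> (Idl (J \<union> set fs))\<rbrakk>
    \<Longrightarrow> has_socle \<mm> (Idl (J \<union> set gs))"
proof (induction k arbitrary: J fs gs)
  case 0
  then show ?case by simp
next
  case (Suc k)
  note J = \<open>ideal J R\<close>
  have \<mm>c: "\<mm> \<subseteq> carrier R" using ideal_simps(2)[OF \<mm>] by auto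
  have Jc: "J \<subseteq> carrier R" using ideal_simps(2)[OF J] by auto
  obtain fs' f where fs: "fs = fs' @ [f]" "length fs' = k"
    using Suc.prems(4) by (metis length_Suc_conv_rev)
  obtain gs' g where gs: "gs = gs' @ [g]" "length gs' = k"
    using Suc.prems(5) by (metis length_Suc_conv_rev)
  have sub: "set fs' \<subseteq> \<mm>" "f \<in> \<mm>" "set gs' \<subseteq> \<mm>" "g \<in> \<mm>"
    using Suc.prems(2,3) fs gs by auto
  let ?\<J> = "(\<lambda>i. Idl (J \<union> set (take i fs))) ` {..k} \<union> (\<lambda>i. Idl (J \<union> set (take i gs))) ` {..k}"
  have "\<exists>z\<in>\<mm>. \<forall>I\<in>?\<J>. nonzerodivisor_mod I z"
  proof (rule common_nonzerodivisor[OF \<mm>])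
    fix I assume "I \<in> ?\<J>"
    then obtain hs i where I: "I = Idl (J \<union> set (take i hs))" and i: "i \<le> k"
      and hs: "hs = fs \<or> hs = gs" by auto
    have 1: "set hs \<subseteq> \<mm>" "length hs = Suc k" "weakly_regular J hs"
      using hs Suc.prems by auto
    have "ideal I R" unfolding I
      using 1(1) \<mm>c Jc set_take_subset[of i hs] by (intro genideal_ideal) auto
    moreover have "\<not> has_socle \<mm> I"
    proof (rule not_has_socle_if_nonzerodivisor)
      show "nonzerodivisor_mod I (hs ! i)" using 1 i by (auto simp: I weakly_regular_def)
      show "hs ! i \<in> \<mm>" using 1 i by auto
    qed
    ultimately show "ideal I R \<and> \<not> has_socle \<mm> I" by simp
  qed auto
  then obtain z where z: "z \<in> \<mm>"
    and zf: "\<And>i. i \<le> k \<Longrightarrow> nonzerodivisor_mod (Idl (J \<union> set (take i fs))) z"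
    and zg: "\<And>i. i \<le> k \<Longrightarrow> nonzerodivisor_mod (Idl (J \<union> set (take i gs))) z"
    by auto
  have zc: "z \<in> carrier R" using z \<mm>c by auto
  let ?J = "Idl (insert z J)"
  have last: "Idl (insert h (Idl (J \<union> set hs))) = Idl (J \<union> set (hs @ [h]))"
    if "set hs \<subseteq> \<mm>" "h \<in> \<mm>" for hs h
    using Idl_Idl_Un[of "J \<union> set hs" "{h}"] that \<mm>c Jc by (simp add: subset_iff)
  have first: "Idl (J \<union> set (hs @ [z])) = Idl (?J \<union> set hs)" if "set hs \<subseteq> \<mm>" for hs
    using Idl_Idl_Un[of "insert z J" "set hs"] that \<mm>c Jc zc by (simp add: subset_iff)
  have idl: "ideal (Idl (J \<union> set hs)) R" if "set hs \<subseteq> \<mm>" for hs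
    using that \<mm>c Jc by (intro genideal_ideal) auto
  have "has_socle \<mm> (Idl (insert z (Idl (J \<union> set fs'))))"
  proof (rule has_socle_swap[OF idl[OF sub(1)] \<mm>c])
    show "nonzerodivisor_mod (Idl (J \<union> set fs')) f"
      using Suc.prems(6) by (simp add: fs weakly_regular_append1)
    show "nonzerodivisor_mod (Idl (J \<union> set fs')) z"
      using zf[of k] fs by simp
    show "has_socle \<mm> (Idl (insert f (Idl (J \<union> set fs'))))"
      unfolding last[OF sub(1,2)] using Suc.prems(8) by (simp only: fs)
  qed (rule z)
  then have soc: "has_socle \<mm> (Idl (?J \<union> set fs'))"
    unfolding last[OF sub(1) z] first[OF sub(1)] .
  have "has_socle \<mm> (Idl (?J \<union> set gs'))"
  proof (rule Suc.IH[OF _ sub(1,3) fs(2) gs(2) _ _ soc])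
    show "ideal ?J R" using zc Jc by (intro genideal_ideal) auto
    show "weakly_regular ?J fs'"
    proof (rule weakly_regular_mod_first[OF J zc])
      show "weakly_regular J fs'" using Suc.prems(6) by (simp add: fs weakly_regular_append1)
      show "nonzerodivisor_mod (Idl (J \<union> set (take i fs'))) z" if "i \<le> length fs'" for i
        using zf[of i] that fs by simp
    qed (use sub \<mm>c in auto)
    show "weakly_regular ?J gs'"
    proof (rule weakly_regular_mod_first[OF J zc])
      show "weakly_regular J gs'" using Suc.prems(7) by (simp add: gs weakly_regular_append1)
      show "nonzerodivisor_mod (Idl (J \<union> set (take i gs'))) z" if "i \<le> length gs'" for i
        using zg[of i] that gs by simp
    qed (use sub \<mm>c in auto)
  qed
  then have soc': "has_socle \<mm> (Idl (insert z (Idl (J \<union> set gs'))))"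
    unfolding last[OF sub(3) z] first[OF sub(3)] .
  have "has_socle \<mm> (Idl (insert g (Idl (J \<union> set gs'))))"
  proof (rule has_socle_swap[OF idl[OF sub(3)] \<mm>c _ _ sub(4) soc'])
    show "nonzerodivisor_mod (Idl (J \<union> set gs')) g"
      using Suc.prems(7) by (simp add: gs weakly_regular_append1)
    show "nonzerodivisor_mod (Idl (J \<union> set gs')) z"
      using zg[of k] gs by simp
  qed
  then show ?case unfolding last[OF sub(3,4)] by (simp only: gs)
qed

end

section \<open>Regular sequences on cyclic modules\<close>

context cring
begin

lemma quot_module_simps:
  assumes "ideal I R"
  shows "carrier (quot_module R I) = (\<lambda>x. I +> x) ` carrier R"
    and "\<zero>\<^bsub>quot_module R I\<^esub> = I +> \<zero>"
    and "x \<in> carrier R \<Longrightarrow> y \<in> carrier R \<Longrightarrow> (I +> x) \<oplus>\<^bsub>quot_module R I\<^esub> (I +> y) = I +> (x \<oplus> y)"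
    and "a \<in> carrier R \<Longrightarrow> x \<in> carrier R \<Longrightarrow> a \<odot>\<^bsub>quot_module R I\<^esub> (I +> x) = I +> (a \<otimes> x)"
proof -
  interpret ideal I R by fact
  interpret h: ring_hom_ring R "R Quot I" "(+>) I" by (rule rcos_ring_hom_ring)
  have simps: "carrier (quot_module R I) = carrier (R Quot I)"
    "add (quot_module R I) = add (R Quot I)" "zero (quot_module R I) = zero (R Quot I)"
    "smult (quot_module R I) = (\<lambda>a X. (I +> a) \<otimes>\<^bsub>R Quot I\<^esub> X)"
    by (simp_all add: quot_module_def ring.defs)
  show "carrier (quot_module R I) = (\<lambda>x. I +> x) ` carrier R"
    by (auto simp: simps FactRing_def A_RCOSETS_def' a_r_coset_def')
  show "\<zero>\<^bsub>quot_module R I\<^esub> = I +> \<zero>" by (simp add: simps)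
  show "x \<in> carrier R \<Longrightarrow> y \<in> carrier R \<Longrightarrow> (I +> x) \<oplus>\<^bsub>quot_module R I\<^esub> (I +> y) = I +> (x \<oplus> y)"
    by (simp add: simps)
  show "a \<in> carrier R \<Longrightarrow> x \<in> carrier R \<Longrightarrow> a \<odot>\<^bsub>quot_module R I\<^esub> (I +> x) = I +> (a \<otimes> x)"
    by (simp add: simps)
qed

text \<open>The submodule \<open>J (R/I)\<close> is the image of \<open>I + J\<close>: the image is a submodule that contains all
  products, and conversely the preimage of \<open>J (R/I)\<close> is an ideal that contains \<open>I\<close> and \<open>J\<close>.\<close>
lemma coset_in_ideal_smult_iff:
  assumes I: "ideal I R" and J: "J \<subseteq> carrier R" and x: "x \<in> carrier R"
  shows "I +> x \<in> ideal_smult R (quot_module R I) J \<longleftrightarrow> x \<in> Idl (I \<union> J)"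
proof
  let ?M = "quot_module R I"
  interpret M: Module.module R ?M by (rule module_quot_module[OF cring_axioms I])
  note Is = ideal_simps[OF I] and Ms = quot_module_simps[OF I]
  have sub: "I \<union> J \<subseteq> carrier R" using J Is by auto
  note K = genideal_ideal[OF sub]
  note Ks = ideal_simps[OF K]
  { assume 1: "I +> x \<in> ideal_smult R ?M J"
    let ?N = "(\<lambda>x. I +> x) ` (Idl (I \<union> J))"
    have "submodule ?N R ?M"
    proof (rule M.submoduleI)
      show "?N \<subseteq> carrier ?M" using Ms(1) Ks(2) by auto
      show "\<zero>\<^bsub>?M\<^esub> \<in> ?N" using Ms(2) Ks(1) by auto
      show add: "a \<oplus>\<^bsub>?M\<^esub> b \<in> ?N" if "a \<in> ?N" "b \<in> ?N" for a b
        using that Ms(3) Ks(2,3) by (auto intro!: imageI)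
      show sm: "a \<odot>\<^bsub>?M\<^esub> b \<in> ?N" if "a \<in> carrier R" "b \<in> ?N" for a b
        using that Ms(4) Ks(2,5) by (auto intro!: imageI)
      show "\<ominus>\<^bsub>?M\<^esub> a \<in> ?N" if "a \<in> ?N" for a
      proof -
        have ac: "a \<in> carrier ?M" using that Ms(1) Ks(2) by auto
        have "\<ominus>\<^bsub>?M\<^esub> a = (\<ominus> \<one>) \<odot>\<^bsub>?M\<^esub> a"
          using M.smult_l_minus[of \<one> a] M.smult_one ac by simp
        then show ?thesis using sm[of "\<ominus> \<one>" a] that by simp
      qed
    qed
    moreover have "\<forall>a\<in>J. \<forall>y\<in>carrier ?M. a \<odot>\<^bsub>?M\<^esub> y \<in> ?N"
    proof (intro ballI)
      fix a y assume a: "a \<in> J" and y: "y \<in> carrier ?M"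
      obtain b where b: "b \<in> carrier R" "y = I +> b" using y Ms(1) by auto
      have "a \<in> Idl (I \<union> J)" using genideal_self[OF sub] a by auto
      then show "a \<odot>\<^bsub>?M\<^esub> y \<in> ?N" using b Ms(4)[of a b] Ks(6)[of a b] J a by auto
    qed
    ultimately have "I +> x \<in> ?N" using 1 unfolding ideal_smult_def by blast
    then obtain y where y: "y \<in> Idl (I \<union> J)" "I +> x = I +> y" by auto
    then have "x \<ominus> y \<in> I" using quotient_eq_iff_same_a_r_cos[OF I x] Ks(2) by blast
    then have "x \<ominus> y \<in> Idl (I \<union> J)" using genideal_self[OF sub] by auto
    then have "(x \<ominus> y) \<oplus> y \<in> Idl (I \<union> J)" using y Ks(3) by blast
    moreover have "(x \<ominus> y) \<oplus> y = x" using x Ks(2)[OF y(1)] by algebra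
    ultimately show "x \<in> Idl (I \<union> J)" by simp }
  { assume 1: "x \<in> Idl (I \<union> J)"
    let ?N = "ideal_smult R ?M J"
    have N: "submodule ?N R ?M" by (rule submodule_ideal_smult[OF M.module_axioms J])
    let ?K = "{y \<in> carrier R. I +> y \<in> ?N}"
    have N0: "\<zero>\<^bsub>?M\<^esub> \<in> ?N"
      using N subgroup.one_closed[of ?N "add_monoid ?M"] by (simp add: submodule_def)
    have "ideal ?K R"
    proof (rule idealI_cring)
      show "\<zero> \<in> ?K" using N0 Ms(2) by simp
      show "y \<oplus> z \<in> ?K" if "y \<in> ?K" "z \<in> ?K" for y z
        using that Ms(3)[of y z] M.submoduleE(5)[OF N, of "I +> y" "I +> z"] by auto
      show "a \<otimes> y \<in> ?K" if "a \<in> carrier R" "y \<in> ?K" for a y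
        using that Ms(4)[of a y] M.submoduleE(4)[OF N, of a "I +> y"] by auto
    qed auto
    moreover have "I \<union> J \<subseteq> ?K"
    proof
      fix y assume y: "y \<in> I \<union> J"
      then have yc: "y \<in> carrier R" using sub by auto
      show "y \<in> ?K"
      proof (cases "y \<in> I")
        case True
        have "y \<ominus> \<zero> \<in> I" using Is(4)[OF True Is(1)] .
        then have "I +> y = I +> \<zero>"
          using quotient_eq_iff_same_a_r_cos[OF I yc, of \<zero>] by simp
        then show ?thesis using N0 Ms(2) yc by simp
      next
        case False
        then have "y \<in> J" using y by auto
        then have "y \<odot>\<^bsub>?M\<^esub> (I +> \<one>) \<in> ?N"
          using Ms(1) unfolding ideal_smult_def by auto
        then show ?thesis using Ms(4)[of y \<one>] yc by simp
      qed
    qed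
    ultimately have "Idl (I \<union> J) \<subseteq> ?K" by (rule genideal_minimal)
    then show "I +> x \<in> ?N" using 1 by auto }
qed

lemma regular_seq_quot_module_iff:
  assumes I: "ideal I R"
  shows "regular_seq R (quot_module R I) fs \<longleftrightarrow>
    set fs \<subseteq> carrier R \<and> weakly_regular I fs \<and> Idl (I \<union> set fs) \<noteq> carrier R"
proof (cases "set fs \<subseteq> carrier R")
  case True
  let ?M = "quot_module R I"
  interpret M: Module.module R ?M by (rule module_quot_module[OF cring_axioms I])
  note Is = ideal_simps[OF I] and Ms = quot_module_simps[OF I]
  have mem: "I +> x \<in> ideal_smult R ?M (Idl (set (take i fs))) \<longleftrightarrow> x \<in> Idl (I \<union> set (take i fs))"
    if "x \<in> carrier R" for i x
  proof -
    have T: "set (take i fs) \<subseteq> carrier R" using True set_take_subset by fastforce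
    have "Idl (set (take i fs)) \<subseteq> carrier R" using ideal_simps(2)[OF genideal_ideal[OF T]] by auto
    moreover have "Idl (I \<union> Idl (set (take i fs))) = Idl (I \<union> set (take i fs))"
      using Idl_Idl_Un[OF T, of I] Is(2) by (auto simp: Un_commute)
    ultimately show ?thesis using coset_in_ideal_smult_iff[OF I _ that] by simp
  qed
  have nzd: "(\<forall>x\<in>carrier ?M.
        fs ! i \<odot>\<^bsub>?M\<^esub> x \<in> ideal_smult R ?M (Idl (set (take i fs))) \<longrightarrow>
        x \<in> ideal_smult R ?M (Idl (set (take i fs))))
     \<longleftrightarrow> nonzerodivisor_mod (Idl (I \<union> set (take i fs))) (fs ! i)" if "i < length fs" for i
  proof -
    have "fs ! i \<in> carrier R" using True that by auto
    then show ?thesis unfolding Ms(1) nonzerodivisor_mod_def by (simp add: Ms(4) mem)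
  qed
  have "ideal_smult R ?M (Idl (set fs)) = carrier ?M \<longleftrightarrow> Idl (I \<union> set fs) = carrier R"
  proof -
    have "Idl (set fs) \<subseteq> carrier R" using ideal_simps(2)[OF genideal_ideal[OF True]] by auto
    then have "ideal_smult R ?M (Idl (set fs)) \<subseteq> carrier ?M"
      using M.submoduleE(1)[OF submodule_ideal_smult[OF M.module_axioms]] by blast
    moreover have "Idl (I \<union> set fs) \<subseteq> carrier R"
      using ideal_simps(2)[OF genideal_ideal[of "I \<union> set fs"]] True Is(2) by auto
    moreover have "carrier ?M \<subseteq> ideal_smult R ?M (Idl (set fs)) \<longleftrightarrow> carrier R \<subseteq> Idl (I \<union> set fs)"
      unfolding Ms(1) using mem[of _ "length fs"] by auto
    ultimately show ?thesis by blast
  qed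
  then show ?thesis unfolding regular_seq_def weakly_regular_def using True nzd by auto
qed (simp add: regular_seq_def)

end

context noetherian_cring
begin

lemma maximal_regular_seq_quot_module_iff:
  assumes I: "ideal I R" and \<mm>: "ideal \<mm> R" "\<mm> \<noteq> carrier R" "I \<subseteq> \<mm>"
  shows "maximal_regular_seq R \<mm> (quot_module R I) fs \<longleftrightarrow>
    set fs \<subseteq> \<mm> \<and> weakly_regular I fs \<and> has_socle \<mm> (Idl (I \<union> set fs))"
proof (cases "set fs \<subseteq> \<mm>")
  case True
  have \<mm>c: "\<mm> \<subseteq> carrier R" using ideal_simps(2)[OF \<mm>(1)] by auto
  have reg: "regular_seq R (quot_module R I) gs \<longleftrightarrow> weakly_regular I gs" if "set gs \<subseteq> \<mm>" for gs
  proof -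
    have "Idl (I \<union> set gs) \<subseteq> \<mm>" using that \<mm> by (intro genideal_minimal) auto
    then show ?thesis using regular_seq_quot_module_iff[OF I] that \<mm> \<mm>c by blast
  qed
  have J: "ideal (Idl (I \<union> set fs)) R" using True \<mm>c \<mm>(3) by (intro genideal_ideal) auto
  have "(\<forall>g\<in>\<mm>. \<not> nonzerodivisor_mod (Idl (I \<union> set fs)) g) \<longleftrightarrow> has_socle \<mm> (Idl (I \<union> set fs))"
    using common_nonzerodivisor[OF \<mm>(1), of "{Idl (I \<union> set fs)}"] J
      not_has_socle_if_nonzerodivisor by auto
  moreover have "regular_seq R (quot_module R I) (fs @ [g]) \<longleftrightarrow>
      weakly_regular I fs \<and> nonzerodivisor_mod (Idl (I \<union> set fs)) g" if "g \<in> \<mm>" for g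
    using reg[of "fs @ [g]"] True that by (simp add: weakly_regular_append1)
  ultimately show ?thesis
    unfolding maximal_regular_seq_def using True reg[OF True] by blast
qed (simp add: maximal_regular_seq_def)

text \<open>One maximal regular sequence determines the depth: if a regular sequence were longer than a
  maximal one, its initial part of the same length would have a socle by exchange, and could not be
  continued.\<close>
theorem depth_quot_module_eqI:
  assumes I: "ideal I R" and \<mm>: "ideal \<mm> R" "\<mm> \<noteq> carrier R" "I \<subseteq> \<mm>"
    and fs: "set fs \<subseteq> \<mm>" "weakly_regular I fs" "has_socle \<mm> (Idl (I \<union> set fs))"
  shows "depth R \<mm> (quot_module R I) = length fs"
proof -
  note iff = maximal_regular_seq_quot_module_iff[OF I \<mm>]
  have shorter: "length gs \<le> length hs"
    if gs: "set gs \<subseteq> \<mm>" "weakly_regular I gs"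
    and hs: "set hs \<subseteq> \<mm>" "weakly_regular I hs" "has_socle \<mm> (Idl (I \<union> set hs))" for gs hs
  proof (rule ccontr)
    assume "\<not> length gs \<le> length hs"
    then have l: "length hs < length gs" by simp
    let ?g = "take (length hs) gs"
    have "set ?g \<subseteq> \<mm>" using gs(1) set_take_subset by fastforce
    then have "has_socle \<mm> (Idl (I \<union> set ?g))"
      using has_socle_exchange[OF \<mm>(1) I hs(1) _ refl _ hs(2) weakly_regular_take[OF gs(2)] hs(3)] l
      by simp
    moreover have "nonzerodivisor_mod (Idl (I \<union> set ?g)) (gs ! length hs)"
      using gs(2) l by (auto simp: weakly_regular_def)
    moreover have "gs ! length hs \<in> \<mm>" using l gs(1) by auto
    ultimately show False using not_has_socle_if_nonzerodivisor by blast
  qed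
  show ?thesis unfolding depth_def
  proof (rule the_equality)
    show "\<exists>gs. maximal_regular_seq R \<mm> (quot_module R I) gs \<and> length gs = length fs"
      using iff fs by blast
    show "d = length fs"
      if "\<exists>gs. maximal_regular_seq R \<mm> (quot_module R I) gs \<and> length gs = d" for d
      using that fs shorter unfolding iff by (metis order_antisym)
  qed
qed

end

section \<open>Polynomial rings over a field are Noetherian\<close>

abbreviation "lookup \<equiv> Poly_Mapping.lookup"
abbreviation "keys \<equiv> Poly_Mapping.keys"
abbreviation "single \<equiv> Poly_Mapping.single"

type_synonym 'v exponent = "'v \<Rightarrow>\<^sub>0 nat"

lemma sum_of_monomials:
  "(\<Sum>m\<in>keys p. single m (lookup p m)) = p"
  by (rule poly_mapping_eqI)
     (auto simp: lookup_sum lookup_single when_def not_in_keys_iff_lookup_eq_zero sum.delta)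

lemma lookup_monomial_times:
  fixes p :: "('v, 'k::comm_ring_1) mpoly"
  shows "lookup (single d c * p) (d + m) = c * lookup p m"
proof -
  have "single d c * p =
      (\<Sum>k\<in>keys p. single (d + k) (c * lookup p k))"
    by (subst (1) sum_of_monomials[symmetric]) (simp add: sum_distrib_left mult_single)
  then show ?thesis
    by (auto simp: lookup_sum lookup_single when_def not_in_keys_iff_lookup_eq_zero sum.delta)
qed

lemma keys_monomial_times:
  fixes p :: "('v, 'k::comm_ring_1) mpoly"
  shows "keys (single d c * p) \<subseteq> (+) d ` keys p"
  using keys_mult[of "single d c" p] by (auto split: if_splits)

lemma exponent_split:
  fixes m :: "'v exponent"
  assumes "lookup m v \<noteq> 0"
  obtains m' where "m = single v 1 + m'"
proof
  show "m = single v 1 + (m - single v 1)"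
    using assms by (intro poly_mapping_eqI) (auto simp: lookup_add lookup_minus lookup_single when_def)
qed

text \<open>A monotone subsequence exists; if it is decreasing, it is constant from its least value on.\<close>
lemma nat_seq_nondecreasing_subseq:
  fixes s :: "nat \<Rightarrow> nat"
  shows "\<exists>r. strict_mono r \<and> incseq (s \<circ> r)"
proof -
  obtain r where r: "strict_mono r" "monoseq (\<lambda>n. s (r n))"
    using seq_monosub[of s] by auto
  show ?thesis
  proof (cases "incseq (\<lambda>n. s (r n))")
    case True then show ?thesis using r by (auto simp: o_def)
  next
    case False
    then have dec: "decseq (\<lambda>n. s (r n))" using r by (auto simp: monoseq_iff)
    have "\<exists>n. (LEAST k. \<exists>n. k = s (r n)) = s (r n)" by (rule LeastI_ex) blast
    then obtain N where N: "s (r N) = (LEAST k. \<exists>n. k = s (r n))" by force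
    have const: "s (r n) = s (r N)" if "n \<ge> N" for n
    proof (rule antisym)
      show "s (r n) \<le> s (r N)" using dec that by (simp add: decseq_def)
      show "s (r N) \<le> s (r n)" unfolding N by (rule Least_le) auto
    qed
    have "s (r (N + n)) = s (r N)" for n by (rule const) simp
    then have "incseq (s \<circ> (\<lambda>n. r (N + n)))" by (simp add: incseq_def)
    moreover have "strict_mono (\<lambda>n. r (N + n))" using r by (auto simp: strict_mono_def)
    ultimately show ?thesis by blast
  qed
qed

lemma simultaneous_nondecreasing_subseq:
  fixes s :: "nat \<Rightarrow> 'v \<Rightarrow> nat"
  assumes "finite V"
  shows "\<exists>r. strict_mono r \<and> (\<forall>v\<in>V. incseq (\<lambda>i. s (r i) v))"
  using assms
proof (induction V)
  case empty
  show ?case by (rule exI[of _ id]) (auto simp: strict_mono_def)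
next
  case (insert v V)
  then obtain r where r: "strict_mono r" "\<forall>v\<in>V. incseq (\<lambda>i. s (r i) v)" by auto
  obtain q where q: "strict_mono q" "incseq ((\<lambda>i. s (r i) v) \<circ> q)"
    using nat_seq_nondecreasing_subseq by blast
  have "incseq (\<lambda>i. s (r (q i)) w)" if "w \<in> insert v V" for w
  proof (cases "w = v")
    case True then show ?thesis using q by (simp add: o_def)
  next
    case False
    then have "incseq (\<lambda>i. s (r i) w)" using r that by auto
    then show ?thesis using strict_mono_mono[OF q(1)] by (auto simp: incseq_def mono_def)
  qed
  moreover have "strict_mono (\<lambda>i. r (q i))" using r q by (auto simp: strict_mono_def)
  ultimately show ?case by (intro exI[of _ "\<lambda>i. r (q i)"]) auto
qed

text \<open>Dickson's lemma, in the form that divisibility of monomials in finitely many variables is a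
  well-quasi-order.\<close>
lemma dickson_lemma:
  fixes s :: "nat \<Rightarrow> 'v exponent"
  assumes "finite V" and V: "\<And>i. keys (s i) \<subseteq> V"
  shows "\<exists>i j d. i < j \<and> keys d \<subseteq> V \<and> s j = s i + d"
proof -
  obtain r where r: "strict_mono r" "\<And>v. v \<in> V \<Longrightarrow> incseq (\<lambda>i. lookup (s (r i)) v)"
    using simultaneous_nondecreasing_subseq[OF assms(1), of "\<lambda>i. lookup (s i)"] by auto
  have le: "lookup (s (r 0)) v \<le> lookup (s (r 1)) v" for v
  proof (cases "v \<in> V")
    case True then show ?thesis using r(2) by (auto simp: incseq_def)
  next
    case False then show ?thesis using V[of "r 0"] by (metis in_keys_iff subsetD zero_le)
  qed
  have "s (r 1) = s (r 0) + (s (r 1) - s (r 0))"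
    using le by (intro poly_mapping_eqI) (simp add: lookup_add lookup_minus)
  moreover have "keys (s (r 1) - s (r 0)) \<subseteq> V"
    using V[of "r 1"] by (auto simp: in_keys_iff lookup_minus)
  moreover have "r 0 < r 1" using r(1) by (simp add: strict_mono_def)
  ultimately show ?thesis by blast
qed

text \<open>The minimal elements of \<open>L\<close> under divisibility form an antichain, which is finite by Dickson's
  lemma; every element of \<open>L\<close> is a multiple of one of them because the total degree decreases
  under proper division.\<close>
lemma finite_divisibility_basis:
  fixes L :: "'v exponent set"
  assumes fin: "finite V" and L: "\<And>m. m \<in> L \<Longrightarrow> keys m \<subseteq> V"
  shows "\<exists>B\<subseteq>L. finite B \<and> (\<forall>m\<in>L. \<exists>b\<in>B. \<exists>d. keys d \<subseteq> V \<and> m = b + d)"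
proof -
  define B where "B = {m \<in> L. \<forall>b\<in>L. \<forall>d. m = b + d \<longrightarrow> d = 0}"
  have "finite B"
  proof (rule ccontr)
    assume "infinite B"
    then obtain s :: "nat \<Rightarrow> 'v exponent" where s: "inj s" "range s \<subseteq> B"
      using infinite_countable_subset by blast
    obtain i j d where ij: "i < j" "s j = s i + d"
      using dickson_lemma[OF fin, of s] s L unfolding B_def by blast
    have "s j \<in> B" "s i \<in> L" using s(2) unfolding B_def by auto
    then have "d = 0" using ij(2) unfolding B_def by blast
    then show False using ij s(1) by (auto simp: inj_def)
  qed
  moreover have "\<exists>b\<in>B. \<exists>d. keys d \<subseteq> V \<and> m = b + d" if "m \<in> L" for m
    using that
  proof (induction "\<Sum>v\<in>V. lookup m v" arbitrary: m rule: less_induct)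
    case less
    show ?case
    proof (cases "m \<in> B")
      case True then show ?thesis by (intro bexI[of _ m] exI[of _ 0]) auto
    next
      case False
      then obtain b d where b: "b \<in> L" "m = b + d" "d \<noteq> 0" using less unfolding B_def by auto
      have kd: "keys d \<subseteq> V"
        using L[OF less.prems] b by (auto simp: in_keys_iff lookup_add)
      obtain v where v: "v \<in> keys d" using b(3) by (metis ex_in_conv keys_eq_empty)
      have "(\<Sum>v\<in>V. lookup b v) < (\<Sum>v\<in>V. lookup m v)"
      proof (rule sum_strict_mono_ex1[OF fin])
        show "\<forall>v\<in>V. lookup b v \<le> lookup m v" using b by (simp add: lookup_add)
        show "\<exists>v\<in>V. lookup b v < lookup m v"
          using v kd b by (intro bexI[of _ v]) (auto simp: lookup_add in_keys_iff)
      qed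
      then obtain b' d' where b': "b' \<in> B" "keys d' \<subseteq> V" "b = b' + d'"
        using less.hyps b(1) by blast
      have "keys (d' + d) \<subseteq> V" using b' kd keys_add[of d' d] by blast
      then show ?thesis using b b' by (metis add.assoc)
    qed
  qed
  ultimately show ?thesis unfolding B_def by (intro exI[of _ B]) (auto simp: B_def)
qed

lemma exponent_le_add:
  fixes m d :: "'v::linorder exponent"
  shows "m \<le> m + d"
proof -
  have "\<not> d < 0" by transfer (auto simp: less_fun_def)
  then have "m + 0 \<le> m + d" by (intro add_left_mono) simp
  then show ?thesis by simp
qed

text \<open>The lexicographic order on exponent vectors extends divisibility, so Dickson's lemma excludes
  infinite descent.\<close>
lemma wf_exponent_order:
  fixes V :: "'v::linorder set"
  assumes "finite V"
  shows "wf {(a, b :: 'v exponent). a < b \<and> keys a \<subseteq> V \<and> keys b \<subseteq> V}"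
  unfolding wf_iff_no_infinite_down_chain
proof
  assume "\<exists>s. \<forall>i. (s (Suc i), s i) \<in>
    {(a, b :: 'v exponent). a < b \<and> keys a \<subseteq> V \<and> keys b \<subseteq> V}"
  then obtain s :: "nat \<Rightarrow> 'v exponent"
    where s: "\<And>i. s (Suc i) < s i" "\<And>i. keys (s i) \<subseteq> V" by auto
  obtain i j d where "i < j" "s j = s i + d" using dickson_lemma[OF assms s(2)] by blast
  moreover have "s j < s i" if "i < j" for i j
    using that by (induction j) (auto simp: less_Suc_eq intro: s(1) less_trans)
  ultimately show False using exponent_le_add[of "s i" d] by fastforce
qed

lemma poly_ring_simps [simp]:
  "a \<otimes>\<^bsub>poly_ring V\<^esub> b = a * b" "a \<oplus>\<^bsub>poly_ring V\<^esub> b = a + b"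
  "\<zero>\<^bsub>poly_ring V\<^esub> = 0" "\<one>\<^bsub>poly_ring V\<^esub> = 1"
  by (simp_all add: poly_ring_def)

lemma carrier_poly_ring:
  "p \<in> carrier (poly_ring V) \<longleftrightarrow> (\<forall>m\<in>keys p. keys m \<subseteq> V)"
  by (simp add: poly_ring_def)

lemma monomial_in_poly_ring:
  "keys m \<subseteq> V \<Longrightarrow> single m c \<in> carrier (poly_ring V)"
  by (simp add: carrier_poly_ring)

text \<open>One step of polynomial division: if the leading monomial of \<open>g\<close> divides that of \<open>p\<close>, a multiple of
  \<open>g\<close> by a single term cancels the leading term of \<open>p\<close>.\<close>
lemma reduce_leading_monomial:
  fixes p g :: "('v::linorder, 'k::field) mpoly"
  assumes g: "g \<noteq> 0" and p: "p \<noteq> 0"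
    and lead: "Max (keys p) = Max (keys g) + d"
  obtains c where "p + single d c * g = 0 \<or>
    Max (keys (p + single d c * g)) < Max (keys p)"
proof
  define b where "b = Max (keys g)"
  define c where "c = - lookup p (b + d) / lookup g b"
  let ?q = "p + single d c * g"
  have b: "b \<in> keys g" unfolding b_def using g by (intro Max_in) auto
  have le: "m \<le> b + d" if "m \<in> keys ?q" for m
  proof -
    have "m \<in> keys p \<union> (+) d ` keys g"
      using that keys_add keys_monomial_times by (metis (no_types, lifting) Un_iff subsetD)
    then show ?thesis
    proof
      assume "m \<in> keys p"
      then show ?thesis using lead by (metis Max_ge b_def finite_keys)
    next
      assume "m \<in> (+) d ` keys g"
      then obtain k where k: "k \<in> keys g" "m = d + k" by auto
      then have "k \<le> b" by (simp add: b_def)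
      then have "d + k \<le> d + b" by (rule add_left_mono)
      then show ?thesis using k by (simp add: add.commute)
    qed
  qed
  have "lookup ?q (b + d) = 0"
    using lookup_monomial_times[of d c g b] b
    by (simp add: lookup_add c_def add.commute[of b d] in_keys_iff)
  then have "b + d \<notin> keys ?q" by (simp add: in_keys_iff)
  then have "m < b + d" if "m \<in> keys ?q" for m
    using le[OF that] that by (metis order_le_less)
  then show "?q = 0 \<or> Max (keys ?q) < Max (keys p)"
    unfolding lead b_def[symmetric] by (metis Max_in finite_keys keys_eq_empty)
qed

text \<open>Hilbert's basis theorem: finitely many elements \<open>A\<close> of the ideal \<open>J\<close> have leading monomials that
  divide the leading monomial of every element of \<open>J\<close>, and repeated reduction by \<open>A\<close> ends in \<open>0\<close>.\<close>
theorem noetherian_poly_ring: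
  assumes fin: "finite (V :: 'v::linorder set)"
  shows "noetherian_cring (poly_ring V :: ('v, 'k::field) mpoly ring)"
proof -
  let ?R = "poly_ring V :: ('v, 'k) mpoly ring"
  interpret cring ?R by (rule cring_poly_ring)
  have "noetherian_ring ?R"
  proof (rule noetherian_ringI)
    fix J assume J: "ideal J ?R"
    note Js = ideal_simps[OF J, simplified]
    let ?lm = "\<lambda>p :: ('v, 'k) mpoly. Max (keys p)"
    have lmV: "keys (?lm p) \<subseteq> V" if "p \<in> J" "p \<noteq> 0" for p
      using Js(2)[OF that(1)] Max_in[of "keys p"] that(2)
      by (simp add: carrier_poly_ring)
    have "\<exists>B\<subseteq>?lm ` (J - {0}). finite B \<and>
        (\<forall>m\<in>?lm ` (J - {0}). \<exists>b\<in>B. \<exists>d. keys d \<subseteq> V \<and> m = b + d)"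
      by (rule finite_divisibility_basis[OF fin]) (use lmV in auto)
    then obtain B where B: "B \<subseteq> ?lm ` (J - {0})" "finite B"
      "\<And>m. m \<in> ?lm ` (J - {0}) \<Longrightarrow> \<exists>b\<in>B. \<exists>d. keys d \<subseteq> V \<and> m = b + d" by auto
    obtain A where A: "A \<subseteq> J - {0}" "finite A" "B = ?lm ` A"
      using finite_subset_image[OF B(2,1)] by blast
    have Ac: "A \<subseteq> carrier ?R" using A Js(2) by blast
    note Is = ideal_simps[OF genideal_ideal[OF Ac], simplified]
    have "p \<in> J \<Longrightarrow> p \<in> genideal ?R A" for p
    proof (induction "?lm p" arbitrary: p rule: wf_induct_rule[OF wf_exponent_order[OF fin]])
      case (1 p)
      show ?case
      proof (cases "p = 0")
        case True then show ?thesis using Is(1) by simp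
      next
        case False
        then obtain g d where g: "g \<in> A" and d: "keys d \<subseteq> V" "?lm p = ?lm g + d"
          using B(3)[of "?lm p"] 1(2) unfolding A(3) by auto
        have gJ: "g \<in> J" "g \<noteq> 0" using g A(1) by auto
        obtain c where c: "p + single d c * g = 0 \<or>
            ?lm (p + single d c * g) < ?lm p"
          using reduce_leading_monomial[OF gJ(2) False d(2)] by blast
        let ?q = "p + single d c * g"
        have qJ: "?q \<in> J"
          using Js(3) 1(2) Js(5)[OF gJ(1) monomial_in_poly_ring[OF d(1)]] by blast
        have q: "?q \<in> genideal ?R A"
        proof (cases "?q = 0")
          case True then show ?thesis using Is(1) by simp
        next
          case q0: False
          show ?thesis by (rule 1(1)[OF _ qJ]) (use c q0 lmV qJ 1(2) False in auto)
        qed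
        have "g \<in> genideal ?R A" using genideal_self[OF Ac] g by auto
        then have "single d (- c) * g \<in> genideal ?R A"
          using Is(5) monomial_in_poly_ring[OF d(1)] by blast
        then have "?q + single d (- c) * g \<in> genideal ?R A" using Is(3) q by blast
        then show ?thesis by (simp add: single_uminus)
      qed
    qed
    moreover have "genideal ?R A \<subseteq> J" by (rule genideal_minimal[OF J]) (use A in auto)
    ultimately show "\<exists>A\<subseteq>carrier ?R. finite A \<and> J = genideal ?R A" using Ac A(2) by blast
  qed
  then show ?thesis by (intro noetherian_cring.intro cring_axioms)
qed

section \<open>Renaming variables\<close>

text \<open>The linear extension of \<open>h\<close> to formal sums. It is needed at two levels: a map \<open>\<sigma>\<close> of variables
  extends to exponent vectors, that is, to formal sums of variables with coefficients in \<open>nat\<close>, and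
  the resulting map of exponent vectors extends to polynomials.\<close>
definition pushforward :: "('a \<Rightarrow> 'b) \<Rightarrow> ('a \<Rightarrow>\<^sub>0 'c) \<Rightarrow> ('b \<Rightarrow>\<^sub>0 'c::comm_monoid_add)" where
  "pushforward h p = (\<Sum>m\<in>keys p. single (h m) (lookup p m))"

lemma pushforward_eq_sum:
  assumes "finite S" "keys p \<subseteq> S"
  shows "pushforward h p = (\<Sum>m\<in>S. single (h m) (lookup p m))"
  unfolding pushforward_def
  by (rule sum.mono_neutral_left) (use assms in \<open>auto simp: in_keys_iff\<close>)

lemma pushforward_zero [simp]: "pushforward h 0 = 0"
  by (simp add: pushforward_def)

lemma pushforward_single [simp]: "pushforward h (single m c) = single (h m) c"
  by (auto simp: pushforward_def)

lemma pushforward_add: "pushforward h (p + q) = pushforward h p + pushforward h q"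
proof -
  let ?S = "keys p \<union> keys q"
  have "pushforward h (p + q) = (\<Sum>m\<in>?S. single (h m) (lookup (p + q) m))"
    using keys_add[of p q] by (intro pushforward_eq_sum) auto
  moreover have "pushforward h p = (\<Sum>m\<in>?S. single (h m) (lookup p m))"
    "pushforward h q = (\<Sum>m\<in>?S. single (h m) (lookup q m))"
    by (intro pushforward_eq_sum; simp)+
  ultimately show ?thesis by (simp add: lookup_add single_add sum.distrib)
qed

lemma pushforward_sum: "pushforward h (\<Sum>i\<in>S. f i) = (\<Sum>i\<in>S. pushforward h (f i))"
  by (induction S rule: infinite_finite_induct) (auto simp: pushforward_add)

lemma pushforward_mult:
  fixes p q :: "'a::monoid_add \<Rightarrow>\<^sub>0 'c::semiring_0"
  assumes "\<And>a b. h (a + b) = h a + h b"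
  shows "pushforward h (p * q) = pushforward h p * pushforward h q"
proof -
  have "p * q = (\<Sum>m\<in>keys p. single m (lookup p m)) * (\<Sum>m\<in>keys q. single m (lookup q m))"
    by (simp add: sum_of_monomials)
  also have "\<dots> = (\<Sum>m\<in>keys p. \<Sum>l\<in>keys q. single (m + l) (lookup p m * lookup q l))"
    by (simp add: sum_product mult_single)
  finally have "pushforward h (p * q) =
      (\<Sum>m\<in>keys p. \<Sum>l\<in>keys q. single (h m + h l) (lookup p m * lookup q l))"
    by (simp add: pushforward_sum assms)
  also have "\<dots> = pushforward h p * pushforward h q"
    by (simp add: pushforward_def sum_product mult_single)
  finally show ?thesis .
qed

lemma keys_pushforward: "keys (pushforward h p) \<subseteq> h ` keys p"
  using keys_sum[of "\<lambda>m. single (h m) (lookup p m)" "keys p"]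
  unfolding pushforward_def by (auto split: if_splits)

definition rename_vars :: "('v \<Rightarrow> 'w) \<Rightarrow> ('v, 'k::comm_ring_1) mpoly \<Rightarrow> ('w, 'k) mpoly" where
  "rename_vars \<sigma> = pushforward (pushforward \<sigma>)"

lemma rename_vars_add: "rename_vars \<sigma> (p + q) = rename_vars \<sigma> p + rename_vars \<sigma> q"
  by (simp add: rename_vars_def pushforward_add)

lemma rename_vars_mult: "rename_vars \<sigma> (p * q) = rename_vars \<sigma> p * rename_vars \<sigma> q"
  by (simp add: rename_vars_def pushforward_mult pushforward_add)

lemma rename_vars_zero [simp]: "rename_vars \<sigma> 0 = 0"
  by (simp add: rename_vars_def)

lemma rename_vars_diff: "rename_vars \<sigma> (p - q) = rename_vars \<sigma> p - rename_vars \<sigma> q"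
  using rename_vars_add[of \<sigma> "p - q" q] by (simp add: algebra_simps)

lemma rename_vars_single [simp]: "rename_vars \<sigma> (single m c) = single (pushforward \<sigma> m) c"
  by (simp add: rename_vars_def)

lemma rename_vars_var [simp]: "rename_vars \<sigma> (var v) = var (\<sigma> v)"
  by (simp add: var_def)

lemma rename_vars_closed:
  assumes "p \<in> carrier (poly_ring V)" "\<sigma> ` V \<subseteq> V"
  shows "rename_vars \<sigma> p \<in> carrier (poly_ring V)"
  unfolding carrier_poly_ring
proof
  fix m assume "m \<in> keys (rename_vars \<sigma> p)"
  then obtain l where l: "l \<in> keys p" "m = pushforward \<sigma> l"
    using keys_pushforward[of "pushforward \<sigma>" p] unfolding rename_vars_def by blast
  then have "keys l \<subseteq> V" using assms(1) by (simp add: carrier_poly_ring)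
  then show "keys m \<subseteq> V" using keys_pushforward[of \<sigma> l] l assms(2) by blast
qed

lemma exponent_induct [consumes 1, case_names zero add]:
  fixes m :: "'v exponent"
  assumes "keys m \<subseteq> V" "P 0" "\<And>v m. v \<in> V \<Longrightarrow> P m \<Longrightarrow> P (single v 1 + m)"
  shows "P m"
  using assms(1)
proof (induction m rule: update_induct)
  case const
  show ?case by (rule assms(2))
next
  case (update m v b)
  have "keys m \<subseteq> V" "v \<in> V" using update by (auto simp: keys_update split: if_splits)
  have "P (single v k + m)" for k
  proof (induction k)
    case 0 then show ?case using update \<open>keys m \<subseteq> V\<close> by simp
  next
    case (Suc k)
    have "single v (Suc k) + m = single v 1 + (single v k + m)"
      by (simp add: single_add[symmetric] add.assoc[symmetric])
    then show ?case using assms(3)[OF \<open>v \<in> V\<close> Suc] by simp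
  qed
  moreover have "Poly_Mapping.update v b m = single v b + m"
    using update.hyps(1)
    by (intro poly_mapping_eqI) (auto simp: lookup_update lookup_add lookup_single when_def in_keys_iff)
  ultimately show ?case by simp
qed

lemma poly_ring_induct [consumes 1, case_names const var add mult]:
  fixes p :: "('v, 'k::comm_ring_1) mpoly"
  assumes p: "p \<in> carrier (poly_ring V)"
    and const: "\<And>c. P (single 0 c)" and var: "\<And>v. v \<in> V \<Longrightarrow> P (var v)"
    and add: "\<And>p q. P p \<Longrightarrow> P q \<Longrightarrow> P (p + q)" and mult: "\<And>p q. P p \<Longrightarrow> P q \<Longrightarrow> P (p * q)"
  shows "P p"
proof -
  have mon: "P (single m c)" if "keys m \<subseteq> V" for m c
    using that
  proof (induction m rule: exponent_induct)
    case zero then show ?case by (rule const)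
  next
    case (add v m)
    have "single (single v 1 + m) c = var v * single m c" by (simp add: var_def mult_single)
    then show ?case using mult[OF var[OF add(1)] add(2)] by simp
  qed
  have "P (\<Sum>m\<in>S. single m (lookup p m))" if "finite S" "S \<subseteq> keys p" for S
    using that
  proof (induction S rule: finite_induct)
    case empty then show ?case using const[of 0] by simp
  next
    case (insert m S)
    then have "keys m \<subseteq> V" using p by (auto simp: carrier_poly_ring)
    then show ?case using insert mon add by simp
  qed
  from this[of "keys p"] show ?thesis by (simp add: sum_of_monomials)
qed

section \<open>Edge ideals modulo identifications of vertices\<close>

text \<open>The exponent vectors of the monomials that are multiples of some \<open>x\<^sub>\<sigma>\<^sub>ax\<^sub>\<sigma>\<^sub>b\<close> with \<open>{a, b} \<in> E\<close>.\<close>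
definition edge_multiples :: "('v \<Rightarrow> 'v) \<Rightarrow> 'v set set \<Rightarrow> 'v exponent set" where
  "edge_multiples \<sigma> E =
     {single (\<sigma> a) 1 + single (\<sigma> b) 1 + d | a b d. {a, b} \<in> E}"

lemma add_in_edge_multiples:
  assumes "m \<in> edge_multiples \<sigma> E"
  shows "d + m \<in> edge_multiples \<sigma> E"
proof -
  obtain a b d' where "{a, b} \<in> E" "m = single (\<sigma> a) 1 + single (\<sigma> b) 1 + d'"
    using assms unfolding edge_multiples_def by blast
  then have "{a, b} \<in> E \<and> d + m = single (\<sigma> a) 1 + single (\<sigma> b) 1 + (d + d')"
    by (simp add: add_ac)
  then show ?thesis unfolding edge_multiples_def by blast
qed

definition folding_relations :: "('v \<Rightarrow> 'v) \<Rightarrow> 'v set \<Rightarrow> ('v, 'k::comm_ring_1) mpoly set" where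
  "folding_relations \<sigma> V = {var v - var (\<sigma> v) | v. v \<in> V \<and> \<sigma> v \<noteq> v}"

lemma poly_ring_diff_closed:
  fixes p q :: "('v, 'k::comm_ring_1) mpoly"
  shows "p \<in> carrier (poly_ring V) \<Longrightarrow> q \<in> carrier (poly_ring V) \<Longrightarrow> p - q \<in> carrier (poly_ring V)"
  using keys_diff[of p q] by (fastforce simp: carrier_poly_ring)

text \<open>Dividing by \<open>x\<^sub>v - x\<^sub>\<sigma>\<^sub>v\<close> amounts to substituting \<open>x\<^sub>\<sigma>\<^sub>v\<close> for \<open>x\<^sub>v\<close>. The substitution kills these
  relations because \<open>\<sigma>\<close> is idempotent, and every polynomial is congruent to its image. So membership can
  be tested on the image, in a monomial ideal, where it is a condition on each monomial separately.\<close>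
lemma edge_ideal_mod_folding:
  fixes V :: "'v set" and E :: "'v set set" and \<sigma> :: "'v \<Rightarrow> 'v"
  defines "R \<equiv> poly_ring V :: ('v, 'k::comm_ring_1) mpoly ring"
  assumes E: "\<And>e. e \<in> E \<Longrightarrow> e \<subseteq> V"
    and \<sigma>: "\<sigma> ` V \<subseteq> V" "\<And>v. v \<in> V \<Longrightarrow> \<sigma> (\<sigma> v) = \<sigma> v"
  shows "genideal R (edge_ideal V E \<union> folding_relations \<sigma> V) =
    {p \<in> carrier R. keys (rename_vars \<sigma> p) \<subseteq> edge_multiples \<sigma> E}"
    (is "?J = ?K")
proof -
  interpret cring R unfolding R_def by (rule cring_poly_ring)
  have simps: "a \<otimes>\<^bsub>R\<^esub> b = a * b" "a \<oplus>\<^bsub>R\<^esub> b = a + b" "\<zero>\<^bsub>R\<^esub> = 0" "\<one>\<^bsub>R\<^esub> = 1" for a b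
    by (simp_all add: R_def)
  note closed = a_closed[unfolded simps] m_closed[unfolded simps]
  have varc: "var v \<in> carrier R" if "v \<in> V" for v using that by (simp add: R_def var_in_poly_ring)
  have I: "ideal (edge_ideal V E :: ('v, 'k) mpoly set) R"
    unfolding R_def by (rule edge_ideal_ideal) (rule E)
  have sub: "edge_ideal V E \<union> folding_relations \<sigma> V \<subseteq> carrier R"
    using ideal_simps(2)[OF I] \<sigma>(1)
    by (auto simp: folding_relations_def R_def intro!: poly_ring_diff_closed var_in_poly_ring)
  note J = genideal_ideal[OF sub]
  note Js = ideal_simps[OF J, unfolded simps]
  have renc: "rename_vars \<sigma> p \<in> carrier R" if "p \<in> carrier R" for p
    using that rename_vars_closed \<sigma>(1) unfolding R_def by blast
  have K: "ideal ?K R"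
  proof (rule idealI_cring, unfold simps)
    show "p + q \<in> ?K" if "p \<in> ?K" "q \<in> ?K" for p q
      using that closed keys_add[of "rename_vars \<sigma> p" "rename_vars \<sigma> q"]
      by (auto simp: rename_vars_add)
    show "p * q \<in> ?K" if "p \<in> carrier R" "q \<in> ?K" for p q
    proof -
      have "keys (rename_vars \<sigma> p * rename_vars \<sigma> q) \<subseteq> edge_multiples \<sigma> E"
      proof
        fix m assume "m \<in> keys (rename_vars \<sigma> p * rename_vars \<sigma> q)"
        then obtain k l where "m = k + l" "l \<in> keys (rename_vars \<sigma> q)"
          using keys_mult[of "rename_vars \<sigma> p" "rename_vars \<sigma> q"] by blast
        then show "m \<in> edge_multiples \<sigma> E" using that(2) add_in_edge_multiples by blast
      qed
      then show ?thesis using that closed(2) by (simp add: rename_vars_mult)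
    qed
  qed (auto simp: R_def carrier_poly_ring)
  have varJ: "var v - var (\<sigma> v) \<in> ?J" if "v \<in> V" for v
  proof (cases "\<sigma> v = v")
    case True then show ?thesis using Js(1) by simp
  next
    case False then show ?thesis
      using that genideal_self[OF sub] by (auto simp: folding_relations_def)
  qed
  have ren: "p \<in> carrier R \<and> p - rename_vars \<sigma> p \<in> ?J" if "p \<in> carrier R" for p
    using that unfolding R_def
  proof (induction p rule: poly_ring_induct)
    case (const c)
    then show ?case using Js(1) by (simp add: carrier_poly_ring R_def)
  next
    case (var v)
    then show ?case using varJ varc by (simp add: R_def)
  next
    case (add p q)
    note add = add[folded R_def]
    have "p + q - rename_vars \<sigma> (p + q) = (p - rename_vars \<sigma> p) + (q - rename_vars \<sigma> q)"
      by (simp add: rename_vars_add)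
    then show ?case unfolding R_def[symmetric] using add Js(3) closed by metis
  next
    case (mult p q)
    note mult = mult[folded R_def]
    have "p * q - rename_vars \<sigma> (p * q) =
        p * (q - rename_vars \<sigma> q) + (p - rename_vars \<sigma> p) * rename_vars \<sigma> q"
      by (simp add: rename_vars_mult algebra_simps)
    then show ?case unfolding R_def[symmetric] using mult Js(3,5,6) closed renc by metis
  qed
  show ?thesis
  proof
    show "?J \<subseteq> ?K"
    proof (rule genideal_minimal[OF K], rule Un_least)
      show "edge_ideal V E \<subseteq> ?K" unfolding edge_ideal_def R_def[symmetric]
      proof (rule genideal_minimal[OF K], safe)
        fix a b assume ab: "{a, b} \<in> E"
        then have "a \<in> V" "b \<in> V" using E by blast+
        then show "var a * var b \<in> carrier R" using closed varc by blast
        have "rename_vars \<sigma> (var a * var b) = single (single (\<sigma> a) 1 + single (\<sigma> b) 1) (1 :: 'k)"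
          by (simp add: rename_vars_mult) (simp add: var_def mult_single)
        moreover have "single (\<sigma> a) 1 + single (\<sigma> b) 1 \<in> edge_multiples \<sigma> E"
          using ab unfolding edge_multiples_def by (metis (mono_tags, lifting) add_0_right mem_Collect_eq)
        ultimately show "m \<in> edge_multiples \<sigma> E"
          if "m \<in> keys (rename_vars \<sigma> (var a * var b :: ('v, 'k) mpoly))" for m
          using that by simp
      qed
      show "folding_relations \<sigma> V \<subseteq> ?K"
        using sub \<sigma>(2) by (auto simp: folding_relations_def rename_vars_diff)
    qed
    show "?K \<subseteq> ?J"
    proof
      fix p assume p: "p \<in> ?K"
      have mon: "single m c \<in> ?J" if m: "m \<in> edge_multiples \<sigma> E" "keys m \<subseteq> V" for m and c :: 'k
      proof -
        obtain a b d where ab: "{a, b} \<in> E" and md: "m = single (\<sigma> a) 1 + single (\<sigma> b) 1 + d"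
          using m(1) unfolding edge_multiples_def by blast
        have V: "a \<in> V" "b \<in> V" "\<sigma> a \<in> V" "\<sigma> b \<in> V" using E[OF ab] \<sigma>(1) by auto
        have "keys d \<subseteq> V" using m(2) md by (auto simp: in_keys_iff lookup_add)
        then have dc: "single d c \<in> carrier R" by (simp add: R_def monomial_in_poly_ring)
        have gens: "{var a * var b | a b. {a, b} \<in> E} \<subseteq> carrier R"
        proof
          fix q :: "('v, 'k) mpoly" assume "q \<in> {var a * var b | a b. {a, b} \<in> E}"
          then obtain a b where q: "q = var a * var b" and "{a, b} \<in> E" by blast
          then have "a \<in> V" "b \<in> V" using E[of "{a, b}"] by auto
          then show "q \<in> carrier R" unfolding q using varc closed(2) by blast
        qed
        have "(var a * var b :: ('v, 'k) mpoly) \<in> edge_ideal V E"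
          unfolding edge_ideal_def R_def[symmetric]
          by (rule subsetD[OF genideal_self[OF gens]]) (use ab in blast)
        then have 1: "var a * var b \<in> ?J" using genideal_self[OF sub] by blast
        have "var (\<sigma> a) * var (\<sigma> b) =
          var a * var b + (var a * (- 1 * (var b - var (\<sigma> b))) + var (\<sigma> b) * (- 1 * (var a - var (\<sigma> a))))"
          by (simp add: algebra_simps)
        moreover have "- 1 * x \<in> ?J" if "x \<in> ?J" for x
        proof -
          have "(- 1 :: ('v, 'k) mpoly) \<in> carrier R" by (simp add: R_def carrier_poly_ring)
          then show ?thesis using Js(5) that by blast
        qed
        ultimately have "var (\<sigma> a) * var (\<sigma> b) \<in> ?J" using 1 varJ V varc Js(3,5) by metis
        then have "single d c * (var (\<sigma> a) * var (\<sigma> b)) \<in> ?J" using Js(5) dc by blast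
        then show ?thesis by (simp add: md var_def mult_single add_ac)
      qed
      let ?q = "rename_vars \<sigma> p"
      have qc: "?q \<in> carrier R" using p renc by blast
      have "(\<Sum>m\<in>S. single m (lookup ?q m)) \<in> ?J" if "finite S" "S \<subseteq> keys ?q" for S
        using that
      proof (induction S rule: finite_induct)
        case empty then show ?case using Js(1) by simp
      next
        case (insert m S)
        then have "m \<in> edge_multiples \<sigma> E" "keys m \<subseteq> V" using p qc by (auto simp: R_def carrier_poly_ring)
        then show ?case using insert mon Js(3) by simp
      qed
      from this[of "keys ?q"] have "?q \<in> ?J" by (simp add: sum_of_monomials)
      then have "(p - ?q) + ?q \<in> ?J" using ren p Js(3) by blast
      then show "p \<in> ?J" by simp
    qed
  qed
qed

text \<open>Each monomial \<open>m\<close> of \<open>q\<close> is seen in the product \<open>(y - x) q\<close> without cancellation: if \<open>x\<close> does not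
  divide \<open>m\<close>, then \<open>y m\<close> occurs in \<open>y q\<close> but not in \<open>x q\<close>, and if \<open>y\<close> does not divide \<open>m\<close>, then \<open>x m\<close> occurs in
  \<open>x q\<close> but not in \<open>y q\<close>. A monomial divisible by both is in \<open>U\<close> anyway. The other hypotheses on \<open>U\<close> allow the extra variable to be cancelled.\<close>
lemma keys_subset_of_leaf_difference_times:
  fixes q :: "('v, 'k::comm_ring_1) mpoly"
  assumes xy: "x \<noteq> y" and q: "keys ((var y - var x) * q) \<subseteq> U"
    and y: "\<And>m. lookup m x = 0 \<Longrightarrow> single y 1 + m \<in> U \<Longrightarrow> m \<in> U"
    and x: "\<And>m. lookup m x \<noteq> 0 \<Longrightarrow> single x 1 + m \<in> U \<Longrightarrow> m \<in> U"
    and both: "\<And>m. lookup m x \<noteq> 0 \<Longrightarrow> lookup m y \<noteq> 0 \<Longrightarrow> m \<in> U"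
  shows "keys q \<subseteq> U"
proof
  fix m assume m: "m \<in> keys q"
  have shift: "lookup (var v * q) (single v 1 + m) = lookup q m" for v
    by (simp add: var_def lookup_monomial_times)
  have zero: "lookup (var v * q) l = 0" if "lookup l v = 0" for v l
  proof (rule ccontr)
    assume "lookup (var v * q) l \<noteq> 0"
    then have "l \<in> keys (single (single v 1) 1 * q)" by (simp add: in_keys_iff var_def)
    then show False using keys_monomial_times that by (fastforce simp: lookup_add)
  qed
  have diff: "lookup ((var y - var x) * q) l = lookup (var y * q) l - lookup (var x * q) l" for l
    by (simp add: left_diff_distrib lookup_minus)
  consider "lookup m x = 0" | "lookup m x \<noteq> 0" "lookup m y = 0" | "lookup m x \<noteq> 0" "lookup m y \<noteq> 0"
    by blast
  then show "m \<in> U"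
  proof cases
    case 1
    then have "lookup (var x * q) (single y 1 + m) = 0"
      using xy by (intro zero) (simp add: lookup_add lookup_single)
    then have "single y 1 + m \<in> keys ((var y - var x) * q)"
      using m by (simp add: in_keys_iff diff shift del: One_nat_def)
    then show ?thesis using q y 1 by blast
  next
    case 2
    then have "lookup (var y * q) (single x 1 + m) = 0"
      using xy by (intro zero) (simp add: lookup_add lookup_single)
    then have "single x 1 + m \<in> keys ((var y - var x) * q)"
      using m by (simp add: in_keys_iff diff shift del: One_nat_def)
    then show ?thesis using q x 2 by blast
  next
    case 3
    then show ?thesis by (rule both)
  qed
qed

text \<open>Let \<open>y\<close> be a leaf attached to \<open>x\<close>, and let \<open>\<sigma>\<close> identify only other vertices. The generators of the
  folded monomial ideal that involve \<open>y\<close> are then divisible by \<open>x y\<close>, and no generator is divisible by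
  \<open>x\<^sup>2\<close>. These two facts are what the cancellation of \<open>y\<close> and of \<open>x\<close> uses.\<close>
lemma leaf_difference_nonzerodivisor:
  fixes V :: "'v set" and E :: "'v set set" and \<sigma> :: "'v \<Rightarrow> 'v"
  defines "R \<equiv> poly_ring V :: ('v, 'k::comm_ring_1) mpoly ring"
  assumes E: "\<And>e. e \<in> E \<Longrightarrow> e \<subseteq> V"
    and \<sigma>: "\<sigma> ` V \<subseteq> V" "\<And>v. v \<in> V \<Longrightarrow> \<sigma> (\<sigma> v) = \<sigma> v"
    and xy: "x \<in> V" "y \<in> V" "x \<noteq> y"
    and fibre_x: "\<And>v. v \<in> V \<Longrightarrow> \<sigma> v = x \<longleftrightarrow> v = x"
    and fibre_y: "\<And>v. v \<in> V \<Longrightarrow> \<sigma> v = y \<longleftrightarrow> v = y"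
    and leaf: "\<And>v. {v, y} \<in> E \<longleftrightarrow> v = x" and loop: "{x} \<notin> E"
  shows "cring.nonzerodivisor_mod R (genideal R (edge_ideal V E \<union> folding_relations \<sigma> V)) (var y - var x)"
proof -
  interpret cring R unfolding R_def by (rule cring_poly_ring)
  let ?U = "edge_multiples \<sigma> E"
  have cancel: "m \<in> ?U" if h: "single v 1 + m = single (\<sigma> a) 1 + single (\<sigma> b) 1 + d"
    "{a, b} \<in> E" "lookup d v \<noteq> 0" for m v a b d
  proof -
    obtain d' where "d = single v 1 + d'" using exponent_split[OF h(3)] .
    then have "single v 1 + m = single v 1 + (single (\<sigma> a) 1 + single (\<sigma> b) 1 + d')"
      using h(1) by (simp add: add_ac)
    then have "m = single (\<sigma> a) 1 + single (\<sigma> b) 1 + d'" by simp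
    then show ?thesis using h(2) unfolding edge_multiples_def by blast
  qed
  have look: "lookup (single v (Suc 0)) w = (if v = w then 1 else 0 :: nat)" for v w :: 'v
    by (simp add: lookup_single when_def)
  have key: "keys p \<subseteq> ?U" if "keys ((var y - var x) * p) \<subseteq> ?U" for p :: "('v, 'k) mpoly"
  proof (rule keys_subset_of_leaf_difference_times[OF xy(3) that])
    fix m assume m: "lookup m x = 0" "single y 1 + m \<in> ?U"
    then obtain a b d where ab: "{a, b} \<in> E"
      and e: "single y 1 + m = single (\<sigma> a) 1 + single (\<sigma> b) 1 + d"
      unfolding edge_multiples_def by blast
    have V: "a \<in> V" "b \<in> V" using E[OF ab] by auto
    have "lookup (single y 1 + m) x = 0" using m(1) xy(3) by (simp add: lookup_add look)
    then have "\<sigma> a \<noteq> x" "\<sigma> b \<noteq> x" unfolding e by (auto simp: lookup_add look)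
    then have "\<sigma> a \<noteq> y" "\<sigma> b \<noteq> y"
      using ab leaf[of a] leaf[of b] fibre_x fibre_y V by (auto simp: insert_commute)
    moreover have "lookup (single y 1 + m) y \<noteq> 0" by (simp add: lookup_add look)
    ultimately have "lookup d y \<noteq> 0" unfolding e by (simp add: lookup_add look)
    then show "m \<in> ?U" using cancel[OF e ab] by simp
  next
    fix m assume m: "lookup m x \<noteq> 0" "single x 1 + m \<in> ?U"
    then obtain a b d where ab: "{a, b} \<in> E"
      and e: "single x 1 + m = single (\<sigma> a) 1 + single (\<sigma> b) 1 + d"
      unfolding edge_multiples_def by blast
    have V: "a \<in> V" "b \<in> V" using E[OF ab] by auto
    have "\<not> (\<sigma> a = x \<and> \<sigma> b = x)" using ab loop V fibre_x by auto
    moreover have "lookup (single x 1 + m) x \<ge> 2" using m(1) by (simp add: lookup_add look)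
    ultimately have "lookup d x \<noteq> 0" unfolding e by (auto simp: lookup_add look split: if_splits)
    then show "m \<in> ?U" using cancel[OF e ab] by simp
  next
    fix m :: "'v exponent" assume m: "lookup m x \<noteq> 0" "lookup m y \<noteq> 0"
    obtain d where d: "m = single x 1 + d" using exponent_split[OF m(1)] .
    then have dy: "lookup d y \<noteq> 0" using m(2) xy(3) by (simp add: lookup_add look)
    obtain d' where d': "d = single y 1 + d'" using exponent_split[OF dy] .
    have "m = single (\<sigma> x) 1 + single (\<sigma> y) 1 + d'"
      using d d' fibre_x[OF xy(1)] fibre_y[OF xy(2)] by (simp add: add_ac)
    then show "m \<in> ?U" using leaf[of x] unfolding edge_multiples_def by blast
  qed
  have f: "rename_vars \<sigma> (var y - var x) = var y - (var x :: ('v, 'k) mpoly)"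
    using fibre_x[OF xy(1)] fibre_y[OF xy(2)] by (simp add: rename_vars_diff)
  have J: "genideal R (edge_ideal V E \<union> folding_relations \<sigma> V) =
      {p \<in> carrier R. keys (rename_vars \<sigma> p) \<subseteq> ?U}"
    unfolding R_def by (rule edge_ideal_mod_folding) (use E \<sigma> in auto)
  have "var y - var x \<in> carrier R"
    unfolding R_def using xy by (intro poly_ring_diff_closed var_in_poly_ring)
  then show ?thesis
    unfolding nonzerodivisor_mod_def J using key by (auto simp: R_def rename_vars_mult f)
qed

section \<open>The graded maximal ideal\<close>

text \<open>The polynomials without constant term form an ideal that contains the variables.\<close>
lemma graded_max_ideal_proper:
  "graded_max_ideal V \<noteq> carrier (poly_ring V :: ('v, 'k::field) mpoly ring)"
proof -
  let ?R = "poly_ring V :: ('v, 'k) mpoly ring"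
  interpret cring ?R by (rule cring_poly_ring)
  let ?K = "{p \<in> carrier ?R. lookup p 0 = 0}"
  have mult0: "lookup (p * q) 0 = 0" if "lookup q 0 = 0" for p q :: "('v, 'k) mpoly"
  proof (rule ccontr)
    assume "lookup (p * q) 0 \<noteq> 0"
    then obtain a b where ab: "0 = a + b" "b \<in> keys q"
      using keys_mult[of p q] by (auto simp: in_keys_iff)
    have "lookup b v = 0" for v using arg_cong[OF ab(1), of "\<lambda>m. lookup m v"] by (simp add: lookup_add)
    then have "b = 0" by (intro poly_mapping_eqI) simp
    then show False using ab(2) that by (simp add: in_keys_iff)
  qed
  have "ideal ?K ?R"
  proof (rule idealI_cring)
    show "p \<oplus>\<^bsub>?R\<^esub> q \<in> ?K" if "p \<in> ?K" "q \<in> ?K" for p q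
      using that a_closed[of p q] by (simp add: lookup_add)
    show "p \<otimes>\<^bsub>?R\<^esub> q \<in> ?K" if "p \<in> carrier ?R" "q \<in> ?K" for p q
      using that m_closed[of p q] by (simp add: mult0)
  qed (auto simp: carrier_poly_ring)
  moreover have "var ` V \<subseteq> ?K"
  proof
    fix p :: "('v, 'k) mpoly" assume "p \<in> var ` V"
    then obtain v where v: "v \<in> V" "p = var v" by auto
    have "single v (1::nat) \<noteq> 0" by (metis lookup_single_eq lookup_zero one_neq_zero)
    then show "p \<in> ?K"
      using v var_in_poly_ring[of v V] by (simp add: var_def lookup_single when_def)
  qed
  ultimately have "graded_max_ideal V \<subseteq> ?K"
    unfolding graded_max_ideal_def by (rule genideal_minimal)
  moreover have "(1 :: ('v, 'k) mpoly) \<notin> ?K" by simp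
  moreover have "(1 :: ('v, 'k) mpoly) \<in> carrier ?R" using one_closed by simp
  ultimately show ?thesis by blast
qed

lemma var_in_graded_max_ideal: "v \<in> V \<Longrightarrow> var v \<in> graded_max_ideal V"
proof -
  interpret cring "poly_ring V" by (rule cring_poly_ring)
  show "v \<in> V \<Longrightarrow> var v \<in> graded_max_ideal V"
    unfolding graded_max_ideal_def
    using genideal_self[of "var ` V"] var_in_poly_ring[of _ V] by auto
qed

lemma edge_ideal_subset_graded_max_ideal:
  fixes V :: "'v set"
  assumes E: "\<And>e. e \<in> E \<Longrightarrow> e \<subseteq> V"
  shows "edge_ideal V E \<subseteq> (graded_max_ideal V :: ('v, 'k::comm_ring_1) mpoly set)"
proof -
  let ?R = "poly_ring V :: ('v, 'k) mpoly ring"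
  interpret cring ?R by (rule cring_poly_ring)
  note M = ideal_simps[OF graded_max_ideal_ideal[of V], simplified]
  show ?thesis unfolding edge_ideal_def
  proof (rule genideal_minimal[OF graded_max_ideal_ideal], safe)
    fix a b assume "{a, b} \<in> E"
    then have "a \<in> V" "b \<in> V" using E[of "{a, b}"] by auto
    then show "var a * var b \<in> (graded_max_ideal V :: ('v, 'k) mpoly set)"
      by (intro M(5) var_in_graded_max_ideal var_in_poly_ring)
  qed
qed

section \<open>The Helm graph\<close>

text \<open>The first \<open>i\<close> whiskers are contracted: the leaf \<open>n + j\<close> goes to its neighbour \<open>j\<close> for \<open>j \<le> i\<close>.\<close>
definition fold_whiskers :: "nat \<Rightarrow> nat \<Rightarrow> nat \<Rightarrow> nat" where
  "fold_whiskers n i v = (if n < v \<and> v \<le> n + i then v - n else v)"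

definition whisker_differences :: "nat \<Rightarrow> (nat, 'k::comm_ring_1) mpoly list" where
  "whisker_differences n = map (\<lambda>j. var (n + j) - var j) [1..<n + 1]"

lemma length_whisker_differences: "length (whisker_differences n) = n"
  by (simp add: whisker_differences_def)

lemma whisker_differences_nth: "i < n \<Longrightarrow> whisker_differences n ! i = var (n + (i + 1)) - var (i + 1)"
  by (simp add: whisker_differences_def nth_append del: upt_Suc)

text \<open>The first \<open>i\<close> elements of the sequence are exactly the relations that contract the first \<open>i\<close>
  whiskers. The element at position \<open>i\<close> belongs to the whisker \<open>i + 1\<close>, which these relations leave alone.\<close>
lemma folding_relations_whiskers:
  assumes "i \<le> n"
  shows "set (take i (whisker_differences n)) = folding_relations (fold_whiskers n i) (helm_verts n)"
proof -
  have "take i [1..<n + 1] = [1..<i + 1]" using assms by (simp add: take_upt del: upt_Suc)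
  then have "set (take i (whisker_differences n)) = (\<lambda>j. var (n + j) - var j) ` {1..i}"
    by (auto simp: whisker_differences_def take_map)
  also have "\<dots> = folding_relations (fold_whiskers n i) (helm_verts n)"
  proof (intro equalityI subsetI)
    fix p assume "p \<in> (\<lambda>j. var (n + j) - var j) ` {1..i}"
    then obtain j where j: "1 \<le> j" "j \<le> i" "p = var (n + j) - var j" by auto
    then have "fold_whiskers n i (n + j) = j" "n + j \<in> helm_verts n" "n + j \<noteq> j"
      using assms by (auto simp: fold_whiskers_def helm_verts_def)
    then show "p \<in> folding_relations (fold_whiskers n i) (helm_verts n)"
      using j unfolding folding_relations_def by (metis (mono_tags, lifting) mem_Collect_eq)
  next
    fix p assume "p \<in> folding_relations (fold_whiskers n i) (helm_verts n)"
    then obtain v where v: "p = var v - var (fold_whiskers n i v)" "fold_whiskers n i v \<noteq> v"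
      unfolding folding_relations_def by blast
    then have "n < v" "v \<le> n + i" "fold_whiskers n i v = v - n"
      by (auto simp: fold_whiskers_def split: if_splits)
    then show "p \<in> (\<lambda>j. var (n + j) - var j) ` {1..i}"
      using v(1) by (intro image_eqI[of _ _ "v - n"]) auto
  qed
  finally show ?thesis .
qed

lemma fold_whiskers_closed: "i \<le> n \<Longrightarrow> fold_whiskers n i ` helm_verts n \<subseteq> helm_verts n"
  by (auto simp: fold_whiskers_def helm_verts_def)

lemma fold_whiskers_idem: "i \<le> n \<Longrightarrow> fold_whiskers n i (fold_whiskers n i v) = fold_whiskers n i v"
  by (auto simp: fold_whiskers_def)

lemma helm_edge_iff:
  "{a, b} \<in> helm_edges n \<longleftrightarrow>
     (\<exists>i. 1 \<le> i \<and> i \<le> n - 1 \<and> (a = i \<and> b = i + 1 \<or> a = i + 1 \<and> b = i)) \<or>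
     (a = n \<and> b = 1 \<or> a = 1 \<and> b = n) \<or>
     (a = 0 \<and> 1 \<le> b \<and> b \<le> n \<or> b = 0 \<and> 1 \<le> a \<and> a \<le> n) \<or>
     (\<exists>i. 1 \<le> i \<and> i \<le> n \<and> (a = i \<and> b = n + i \<or> a = n + i \<and> b = i))"
  unfolding helm_edges_def cycle_edges_def by (auto simp: doubleton_eq_iff)

lemma helm_loopless: "n \<ge> 3 \<Longrightarrow> {a} \<notin> helm_edges n"
  using helm_edge_iff[of a a n] by auto

lemma helm_edge_to_leaf_iff:
  assumes "n \<ge> 3" "1 \<le> j" "j \<le> n"
  shows "{v, n + j} \<in> helm_edges n \<longleftrightarrow> v = j"
  using assms unfolding helm_edge_iff by auto

lemma helm_weakly_regular_whisker_differences:
  fixes n :: nat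
  defines "R \<equiv> poly_ring (helm_verts n) :: (nat, 'k::field) mpoly ring"
  assumes n: "n \<ge> 3"
  shows "cring.weakly_regular R (edge_ideal (helm_verts n) (helm_edges n)) (whisker_differences n)"
proof -
  interpret cring R unfolding R_def by (rule cring_poly_ring)
  show ?thesis
    unfolding weakly_regular_def length_whisker_differences
  proof (intro allI impI)
    fix i assume i: "i < n"
    have "nonzerodivisor_mod
        (genideal R (edge_ideal (helm_verts n) (helm_edges n) \<union>
           folding_relations (fold_whiskers n i) (helm_verts n)))
        (var (n + (i + 1)) - var (i + 1))"
      unfolding R_def
    proof (rule leaf_difference_nonzerodivisor)
      show "e \<subseteq> helm_verts n" if "e \<in> helm_edges n" for e using helm_simple_graph n that by blast
      show "fold_whiskers n i ` helm_verts n \<subseteq> helm_verts n" using fold_whiskers_closed i by simp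
      show "fold_whiskers n i (fold_whiskers n i v) = fold_whiskers n i v" for v using fold_whiskers_idem i by simp
      show "{v, n + (i + 1)} \<in> helm_edges n \<longleftrightarrow> v = i + 1" for v
        using helm_edge_to_leaf_iff[OF n, of "i + 1"] i by simp
      show "{i + 1} \<notin> helm_edges n" by (rule helm_loopless[OF n])
    qed (use i in \<open>auto simp: fold_whiskers_def helm_verts_def\<close>)
    then show "nonzerodivisor_mod
        (genideal R (edge_ideal (helm_verts n) (helm_edges n) \<union> set (take i (whisker_differences n))))
        (whisker_differences n ! i)"
      using i by (simp add: folding_relations_whiskers whisker_differences_nth)
  qed
qed

lemma maximal_independent_set_of_rim:
  assumes n: "n \<ge> 3"
  obtains S where "S \<subseteq> {1..n}" "S \<noteq> {}"
    "\<And>a b. a \<in> S \<Longrightarrow> b \<in> S \<Longrightarrow> {a, b} \<notin> helm_edges n"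
    "\<And>u. u \<in> {1..n} - S \<Longrightarrow> \<exists>w\<in>S. {u, w} \<in> helm_edges n"
proof -
  define I where "I = {S. S \<subseteq> {1..n} \<and> (\<forall>a\<in>S. \<forall>b\<in>S. {a, b} \<notin> helm_edges n)}"
  have "finite I" unfolding I_def by (rule finite_subset[of _ "Pow {1..n}"]) auto
  moreover have "{1} \<in> I" using n helm_loopless[OF n, of 1] by (auto simp: I_def)
  ultimately obtain S where SI: "S \<in> I" "{1} \<subseteq> S" and max: "\<And>T. T \<in> I \<Longrightarrow> S \<subseteq> T \<Longrightarrow> S = T"
    using finite_has_maximal2[of I "{1}"] by metis
  from SI have S: "S \<subseteq> {1..n}" "\<And>a b. a \<in> S \<Longrightarrow> b \<in> S \<Longrightarrow> {a, b} \<notin> helm_edges n" "S \<noteq> {}"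
    by (auto simp: I_def)
  show ?thesis
  proof (rule that[of S])
    fix u assume u: "u \<in> {1..n} - S"
    then have "insert u S \<notin> I" using max[of "insert u S"] by blast
    then obtain a b where ab: "a \<in> insert u S" "b \<in> insert u S" "{a, b} \<in> helm_edges n"
      using u S(1) unfolding I_def by blast
    have "\<not> (a = u \<and> b = u)" using ab(3) helm_loopless[OF n, of u] by auto
    then consider "a = u" "b \<in> S" | "b = u" "a \<in> S" using ab S(2)[of a b] by blast
    then show "\<exists>w\<in>S. {u, w} \<in> helm_edges n"
    proof cases
      case 1 then show ?thesis using ab(3) by blast
    next
      case 2 then show ?thesis using ab(3) by (metis insert_commute)
    qed
  qed (use S in auto)
qed

text \<open>After contraction of all whiskers, let \<open>z\<close> be the product of the \<open>x\<^sub>i\<close> over a maximal independent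
  set \<open>S\<close> of the cycle. It is not in the ideal, because it is square-free and involves no two adjacent
  vertices. A vertex \<open>u\<close> of the cycle kills it: for \<open>u \<in> S\<close> by the square that comes from the whisker at \<open>u\<close>,
  for other \<open>u\<close> by an edge to \<open>S\<close>, which exists because \<open>S\<close> is maximal. The hub \<open>0\<close> is adjacent to all
  of \<open>S\<close>, and \<open>S\<close> is nonempty.\<close>
lemma helm_has_socle_whisker_differences:
  fixes n :: nat
  defines "R \<equiv> poly_ring (helm_verts n) :: (nat, 'k::field) mpoly ring"
  assumes n: "n \<ge> 3"
  shows "cring.has_socle R (graded_max_ideal (helm_verts n))
    (genideal R (edge_ideal (helm_verts n) (helm_edges n) \<union> set (whisker_differences n)))"
    (is "cring.has_socle R ?\<mm> ?J")
proof -
  interpret cring R unfolding R_def by (rule cring_poly_ring)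
  let ?V = "helm_verts n" and ?E = "helm_edges n" and ?\<sigma> = "fold_whiskers n n"
  let ?U = "edge_multiples ?\<sigma> ?E"
  have Jeq: "?J = {p \<in> carrier R. keys (rename_vars ?\<sigma> p) \<subseteq> ?U}"
  proof -
    have "set (whisker_differences n) = (folding_relations ?\<sigma> ?V :: (nat, 'k) mpoly set)"
      using folding_relations_whiskers[of n n] length_whisker_differences[of n] by (metis order_refl take_all)
    moreover have "genideal R (edge_ideal ?V ?E \<union> folding_relations ?\<sigma> ?V) =
        {p \<in> carrier R. keys (rename_vars ?\<sigma> p) \<subseteq> ?U}"
      unfolding R_def
      by (rule edge_ideal_mod_folding)
         (use helm_simple_graph n fold_whiskers_closed fold_whiskers_idem in auto)
    ultimately show ?thesis by simp
  qed
  obtain S where S: "S \<subseteq> {1..n}" "S \<noteq> {}"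
    and indep: "\<And>a b. a \<in> S \<Longrightarrow> b \<in> S \<Longrightarrow> {a, b} \<notin> ?E"
    and maxi: "\<And>u. u \<in> {1..n} - S \<Longrightarrow> \<exists>w\<in>S. {u, w} \<in> ?E"
    using maximal_independent_set_of_rim[OF n] by metis
  have finS: "finite S" using S(1) finite_subset by blast
  define s where "s = (\<Sum>i\<in>S. single i (1::nat))"
  have look: "lookup s v = (if v \<in> S then 1 else 0)" for v
    using finS by (simp add: s_def lookup_sum lookup_single when_def)
  have look1: "lookup (single v (Suc 0)) w = (if v = w then 1 else 0)" for v w :: nat
    by (simp add: lookup_single when_def)
  have keys_s: "keys s = S" by (auto simp: in_keys_iff look split: if_splits)
  have fix_S: "?\<sigma> i = i" if "i \<in> {0..n}" for i using that by (auto simp: fold_whiskers_def)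
  have push_s: "pushforward ?\<sigma> s = s"
  proof -
    have "pushforward ?\<sigma> s = (\<Sum>i\<in>S. single (?\<sigma> i) 1)" by (simp add: s_def pushforward_sum)
    also have "\<dots> = s" unfolding s_def using S(1) fix_S by (intro sum.cong refl) auto
    finally show ?thesis .
  qed
  have s_notin: "s \<notin> ?U"
  proof
    assume "s \<in> ?U"
    then obtain a b d where ab: "{a, b} \<in> ?E" and s: "s = single (?\<sigma> a) 1 + single (?\<sigma> b) 1 + d"
      unfolding edge_multiples_def by blast
    have "lookup s (?\<sigma> a) \<noteq> 0" "lookup s (?\<sigma> b) \<noteq> 0"
      by (subst s, simp add: lookup_add look1)+
    then have mem: "?\<sigma> a \<in> S" "?\<sigma> b \<in> S" by (auto simp: look split: if_splits)
    have ne: "?\<sigma> a \<noteq> ?\<sigma> b"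
    proof
      assume "?\<sigma> a = ?\<sigma> b"
      then have "lookup s (?\<sigma> a) \<ge> 2" by (subst s) (simp add: lookup_add look1)
      then show False by (auto simp: look split: if_splits)
    qed
    \<comment> \<open>An edge at a leaf is a whisker, and its two ends are folded to the same vertex.\<close>
    have "?\<sigma> a \<noteq> 0" "?\<sigma> b \<noteq> 0" using mem S(1) by auto
    then have "?\<sigma> a = a" "?\<sigma> b = b"
      using ab ne n unfolding helm_edge_iff by (auto simp: fold_whiskers_def split: if_splits)
    then show False using indep mem ab by simp
  qed
  have s_split: "\<exists>d. s = single v 1 + d" if "v \<in> S" for v
    using exponent_split[of s v] that by (metis look one_neq_zero)
  have annih: "single (?\<sigma> v) 1 + s \<in> ?U" if v: "v \<in> ?V" for v
  proof -
    define u where "u = ?\<sigma> v"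
    have u: "u \<le> n" using v by (auto simp: u_def fold_whiskers_def helm_verts_def)
    \<comment> \<open>The folded edge from \<open>u\<close> to an element \<open>w\<close> of \<open>S\<close> comes from an edge of the graph whose other end
      \<open>c\<close> is \<open>w\<close> itself or, when \<open>u = w\<close>, the leaf at \<open>w\<close>.\<close>
    obtain w c where w: "w \<in> S" "{u, c} \<in> ?E" "?\<sigma> c = w"
    proof -
      consider "u = 0" | "u \<in> S" | "u \<in> {1..n} - S" using u by force
      then show thesis
      proof cases
        case 1
        obtain j where j: "j \<in> S" using S(2) by auto
        then have "j \<in> {1..n}" using S(1) by blast
        then have "{u, j} \<in> ?E" "?\<sigma> j = j" using 1 by (auto simp: helm_edge_iff fold_whiskers_def)
        then show thesis by (rule that[OF j])
      next
        case 2
        then have "u \<in> {1..n}" using S(1) by blast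
        then have "{u, n + u} \<in> ?E" "?\<sigma> (n + u) = u"
          by (auto simp: helm_edge_iff fold_whiskers_def)
        then show thesis by (rule that[OF 2])
      next
        case 3
        then obtain w where w: "w \<in> S" "{u, w} \<in> ?E" using maxi by blast
        have "?\<sigma> w = w" using w(1) S(1) by (intro fix_S) auto
        then show thesis by (rule that[OF w])
      qed
    qed
    obtain d where "s = single w 1 + d" using s_split[OF w(1)] by blast
    then have "single u 1 + s = single (?\<sigma> u) 1 + single (?\<sigma> c) 1 + d"
      using w(3) fix_S[of u] u by (simp add: add.assoc)
    then show ?thesis using w(2) unfolding edge_multiples_def u_def[symmetric] by blast
  qed
  define z where "z = (single s 1 :: (nat, 'k) mpoly)"
  have SV: "S \<subseteq> ?V" using S(1) by (auto simp: helm_verts_def)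
  have zc: "z \<in> carrier R" using SV by (simp add: z_def R_def monomial_in_poly_ring keys_s)
  have "z \<notin> ?J" using s_notin by (simp add: Jeq z_def push_s)
  moreover have "a \<otimes>\<^bsub>R\<^esub> z \<in> ?J" if a: "a \<in> ?\<mm>" for a
  proof -
    have sub: "edge_ideal ?V ?E \<union> set (whisker_differences n) \<subseteq> carrier R"
    proof -
      have "ideal (edge_ideal ?V ?E :: (nat, 'k) mpoly set) R"
        unfolding R_def by (rule edge_ideal_ideal) (use helm_simple_graph[OF n] in blast)
      then have "edge_ideal ?V ?E \<subseteq> carrier R" using ideal_simps(2) by blast
      moreover have "set (whisker_differences n) \<subseteq> carrier R"
        by (auto simp: whisker_differences_def R_def helm_verts_def intro!: poly_ring_diff_closed var_in_poly_ring)
      ultimately show ?thesis by blast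
    qed
    have "?\<mm> \<subseteq> colon ?J z"
      unfolding graded_max_ideal_def R_def[symmetric]
    proof (rule genideal_minimal[OF colon_ideal[OF genideal_ideal[OF sub] zc]])
      show "var ` ?V \<subseteq> colon ?J z"
      proof
        fix p :: "(nat, 'k) mpoly" assume "p \<in> var ` ?V"
        then obtain v where v: "v \<in> ?V" "p = var v" by auto
        have pc: "p \<in> carrier R" using v by (simp add: R_def var_in_poly_ring)
        have "p * z = single (single v 1 + s) 1" by (simp add: v z_def var_def mult_single)
        then have "keys (rename_vars ?\<sigma> (p * z)) \<subseteq> ?U"
          using annih[OF v(1)] by (simp add: pushforward_add push_s)
        moreover have "p \<otimes>\<^bsub>R\<^esub> z = p * z" by (simp add: R_def)
        ultimately show "p \<in> colon ?J z"
          unfolding colon_def Jeq using m_closed[OF pc zc] pc by simp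
      qed
    qed
    then show ?thesis using a unfolding colon_def by blast
  qed
  ultimately show ?thesis unfolding has_socle_def using zc by blast
qed

theorem theorem4p1:
  fixes n :: nat
    and \<A> :: "(nat, 'k::field) mpoly ring"
  assumes "n \<ge> 3"
    and "\<A> = poly_ring (helm_verts n)"
  shows "depth \<A> (graded_max_ideal (helm_verts n))
           (quot_module \<A> (edge_ideal (helm_verts n) (helm_edges n))) = n"
proof -
  have fin: "finite (helm_verts n)" by (simp add: helm_verts_def)
  interpret noetherian_cring \<A> unfolding assms(2) by (rule noetherian_poly_ring[OF fin])
  have E: "e \<subseteq> helm_verts n" if "e \<in> helm_edges n" for e
    using helm_simple_graph[OF assms(1) that] by simp
  have M: "ideal (graded_max_ideal (helm_verts n)) \<A>"
    unfolding assms(2) by (rule graded_max_ideal_ideal)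
  note Ms = ideal_simps[OF M]
  have seq: "set (whisker_differences n) \<subseteq> (graded_max_ideal (helm_verts n) :: (nat, 'k) mpoly set)"
  proof
    fix p :: "(nat, 'k) mpoly" assume "p \<in> set (whisker_differences n)"
    then obtain j where j: "1 \<le> j" "j \<le> n" "p = var (n + j) - var j"
      by (auto simp: whisker_differences_def)
    then have "var (n + j) \<in> (graded_max_ideal (helm_verts n) :: (nat, 'k) mpoly set)"
      "var j \<in> (graded_max_ideal (helm_verts n) :: (nat, 'k) mpoly set)"
      by (auto simp: helm_verts_def intro!: var_in_graded_max_ideal)
    moreover have "(- 1 :: (nat, 'k) mpoly) \<in> carrier \<A>"
      by (simp add: assms(2) carrier_poly_ring)
    ultimately have "var (n + j) \<oplus>\<^bsub>\<A>\<^esub> (- 1) \<otimes>\<^bsub>\<A>\<^esub> var j \<in> graded_max_ideal (helm_verts n)"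
      using Ms(3,5) by blast
    then show "p \<in> graded_max_ideal (helm_verts n)" by (simp add: assms(2) j(3))
  qed
  have "depth \<A> (graded_max_ideal (helm_verts n))
      (quot_module \<A> (edge_ideal (helm_verts n) (helm_edges n))) = length (whisker_differences n :: (nat, 'k) mpoly list)"
  proof (rule depth_quot_module_eqI[OF _ M _ _ seq])
    show "ideal (edge_ideal (helm_verts n) (helm_edges n)) \<A>"
      unfolding assms(2) by (rule edge_ideal_ideal) (rule E)
    show "graded_max_ideal (helm_verts n) \<noteq> carrier \<A>"
      unfolding assms(2) by (rule graded_max_ideal_proper)
    show "edge_ideal (helm_verts n) (helm_edges n) \<subseteq> (graded_max_ideal (helm_verts n) :: (nat, 'k) mpoly set)"
      by (rule edge_ideal_subset_graded_max_ideal) (rule E)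
    show "weakly_regular (edge_ideal (helm_verts n) (helm_edges n)) (whisker_differences n)"
      unfolding assms(2) by (rule helm_weakly_regular_whisker_differences[OF assms(1)])
    show "has_socle (graded_max_ideal (helm_verts n))
        (genideal \<A> (edge_ideal (helm_verts n) (helm_edges n) \<union> set (whisker_differences n)))"
      unfolding assms(2) by (rule helm_has_socle_whisker_differences[OF assms(1)])
  qed
  then show ?thesis by (simp add: length_whisker_differences)
qed

end
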